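(* The variety of $4$-dimensional nilpotent Novikov algebras over $\mathbb C$ has exactly two irreducible components, and they are defined by the two infinite families of algebras $\{\mathcal N^4_{20}(\alpha)\}_{\alpha\in\mathbb C}$ and $\{\mathcal N^4_{22}(\lambda)\}_{\lambda\in\mathbb C}$; that is, the two irreducible components are the Zariski closures $\overline{\bigcup_{\alpha\in\mathbb C}O(\mathcal N^4_{20}(\alpha))}$ and $\overline{\bigcup_{\lambda\in\mathbb C}O(\mathcal N^4_{22}(\lambda))}$. Here, in a basis $e_1,e_2,e_3,e_4$ (products of basis elements not listed are zero): $\mathcal N^4_{20}(\alpha)$: $e_1e_2=e_3$, $e_1e_1=\alpha e_4$, $e_1e_3=e_4$, $e_2e_2=e_4$, $e_2e_3=e_4$, $e_3e_2=-e_4$; $\mathcal N^4_{22}(\lambda)$: $e_1e_1=e_2$, $e_1e_2=e_3$, $e_1e_3=(2-\lambda)e_4$, $e_2e_1=\lambda e_3$, $e_2e_2=\lambda e_4$, $e_3e_1=\lambda e_4$.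
   Context: An algebra over $\mathbb C$ is a $\mathbb C$-vector space with a bilinear product (not assumed associative, commutative or unital). A Novikov algebra is an algebra satisfying, for all $x,y,z$, the identities $$(xy)z=(xz)y,\qquad (xy)z-x(yz)=(yx)z-y(xz).$$ An algebra is nilpotent if there is $k\ge1$ such that every product of $k$ of its elements, with any arrangement of brackets, is zero. Let $\mathbb V$ be a $4$-dimensional complex vector space with a fixed basis $e_1,\dots,e_4$. A bilinear product on $\mathbb V$ is an element $\mu\in\mathrm{Hom}(\mathbb V\otimes\mathbb V,\mathbb V)$, determined by its structure constants $c_{ij}^k\in\mathbb C$, where $\mu(e_i\otimes e_j)=\sum_k c_{ij}^k e_k$; this identifies $\mathrm{Hom}(\mathbb V\otimes\mathbb V,\mathbb V)$ with the affine space $\mathbb C^{64}$, equipped with the Zariski topology. The variety of $4$-dimensional nilpotent Novikov algebras is the (Zariski-closed) subset of those $\mu$ that define a nilpotent Novikov algebra structure on $\mathbb V$. The group $GL(\mathbb V)$ acts on it by $(g*\mu)(x\otimes y)=g\mu(g^{-1}x\otimes g^{-1}y)$, and the orbits correspond to isomorphism classes of algebras. For an algebra $\mathcal A$ represented by a structure $\mu$, $O(\mathcal A)=O(\mu)$ denotes the $GL(\mathbb V)$-orbit of $\mu$. An irreducible component is a maximal irreducible closed subset. *)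

theory Defs
  imports "HOL-Analysis.Analysis"
begin

section \<open>The Zariski topology on affine space\<close>

inductive polynomial_fun :: "(complex ^ 'n \<Rightarrow> complex) \<Rightarrow> bool" where
  const: "polynomial_fun (\<lambda>x. a)"
| coord: "polynomial_fun (\<lambda>x. x $ i)"
| add: "polynomial_fun p \<Longrightarrow> polynomial_fun q \<Longrightarrow> polynomial_fun (\<lambda>x. p x + q x)"
| mult: "polynomial_fun p \<Longrightarrow> polynomial_fun q \<Longrightarrow> polynomial_fun (\<lambda>x. p x * q x)"

definition zero_locus :: "(complex ^ 'n \<Rightarrow> complex) set \<Rightarrow> (complex ^ 'n) set" where
  "zero_locus P = {x. \<forall>p\<in>P. p x = 0}"

definition algebraic_set :: "(complex ^ 'n) set \<Rightarrow> bool" where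
  "algebraic_set S \<longleftrightarrow> (\<exists>P. (\<forall>p\<in>P. polynomial_fun p) \<and> S = zero_locus P)"

definition zariski :: "(complex ^ 'n) topology" where
  "zariski = topology (\<lambda>U. algebraic_set (- U))"

lemma algebraic_set_Un:
  assumes "algebraic_set S" "algebraic_set T"
  shows "algebraic_set (S \<union> T)"
proof -
  obtain P Q where P: "\<forall>p\<in>P. polynomial_fun p" "S = zero_locus P"
    and Q: "\<forall>p\<in>Q. polynomial_fun p" "T = zero_locus Q"
    using assms unfolding algebraic_set_def by auto
  let ?R = "{\<lambda>x. p x * q x | p q. p \<in> P \<and> q \<in> Q}"
  have "\<forall>r\<in>?R. polynomial_fun r"
    using P(1) Q(1) by (auto intro: polynomial_fun.mult)
  moreover have "S \<union> T = zero_locus ?R"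
  proof
    show "S \<union> T \<subseteq> zero_locus ?R"
      unfolding P(2) Q(2) zero_locus_def by auto
    show "zero_locus ?R \<subseteq> S \<union> T"
    proof
      fix x assume x: "x \<in> zero_locus ?R"
      have "p x * q x = 0" if "p \<in> P" "q \<in> Q" for p q
      proof -
        have "(\<lambda>x. p x * q x) \<in> ?R" using that by blast
        moreover have "\<forall>r\<in>?R. r x = 0" using x unfolding zero_locus_def mem_Collect_eq .
        ultimately show ?thesis by (rule bspec[rotated])
      qed
      then show "x \<in> S \<union> T"
        unfolding P(2) Q(2) zero_locus_def by (auto simp: mult_eq_0_iff)
    qed
  qed
  ultimately show ?thesis unfolding algebraic_set_def by blast
qed

lemma algebraic_set_Inter:
  assumes "\<And>S. S \<in> F \<Longrightarrow> algebraic_set S"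
  shows "algebraic_set (\<Inter>F)"
proof -
  obtain P where P: "\<And>S. S \<in> F \<Longrightarrow> (\<forall>p\<in>P S. polynomial_fun p) \<and> S = zero_locus (P S)"
    using assms unfolding algebraic_set_def by metis
  have "\<forall>p\<in>(\<Union>S\<in>F. P S). polynomial_fun p" using P by blast
  moreover have "\<Inter>F = zero_locus (\<Union>S\<in>F. P S)"
  proof -
    have "x \<in> S \<longleftrightarrow> (\<forall>p\<in>P S. p x = 0)" if "S \<in> F" for S x
      using P[OF that] unfolding zero_locus_def by auto
    then show ?thesis unfolding zero_locus_def by auto
  qed
  ultimately show ?thesis unfolding algebraic_set_def by blast
qed

lemma istopology_zariski: "istopology (\<lambda>U. algebraic_set (- U))"
  unfolding istopology_def
proof (intro conjI allI impI)
  fix S T :: "(complex ^ 'n) set"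
  assume "algebraic_set (- S)" "algebraic_set (- T)"
  then show "algebraic_set (- (S \<inter> T))"
    by (simp add: Compl_Int algebraic_set_Un)
next
  fix K :: "(complex ^ 'n) set set"
  assume "\<forall>S\<in>K. algebraic_set (- S)"
  then have "algebraic_set (\<Inter>(uminus ` K))" by (intro algebraic_set_Inter) auto
  moreover have "\<Inter>(uminus ` K) = - \<Union>K" by auto
  ultimately show "algebraic_set (- \<Union>K)" by simp
qed

lemma openin_zariski: "openin zariski U \<longleftrightarrow> algebraic_set (- U)"
  unfolding zariski_def topology_inverse'[OF istopology_zariski] ..

lemma topspace_zariski [simp]: "topspace zariski = UNIV"
proof -
  have "algebraic_set ({} :: (complex ^ 'n) set)"
    unfolding algebraic_set_def
    by (rule exI[of _ "{\<lambda>x. 1}"]) (auto simp: zero_locus_def intro: polynomial_fun.const)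
  then have "openin zariski (UNIV :: (complex ^ 'n) set)"
    by (simp add: openin_zariski)
  from openin_subset[OF this] show ?thesis by (rule top.extremum_uniqueI)
qed

lemma closedin_zariski: "closedin zariski S \<longleftrightarrow> algebraic_set S"
proof -
  have "- (UNIV - S) = S" by blast
  then show ?thesis unfolding closedin_def openin_zariski topspace_zariski by simp
qed

section \<open>Irreducible components\<close>

definition irreducible_in :: "'a topology \<Rightarrow> 'a set \<Rightarrow> bool" where
  "irreducible_in X S \<longleftrightarrow> S \<subseteq> topspace X \<and> S \<noteq> {} \<and>
     (\<forall>A B. closedin X A \<and> closedin X B \<and> S \<subseteq> A \<union> B \<longrightarrow> S \<subseteq> A \<or> S \<subseteq> B)"

definition irreducible_components :: "'a topology \<Rightarrow> 'a set set" where
  "irreducible_components X =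
     {C. closedin X C \<and> irreducible_in X C \<and>
         (\<forall>D. closedin X D \<and> irreducible_in X D \<and> C \<subseteq> D \<longrightarrow> D = C)}"

section \<open>Algebra structures given by structure constants\<close>

text \<open>
  The entry \<open>c $ (i, j, k)\<close> is the coefficient of \<open>e\<^sub>k\<close> in \<open>e\<^sub>i e\<^sub>j\<close>, where \<open>e\<^sub>i\<close> is \<open>axis i 1\<close>.
\<close>

type_synonym 'n alg_structure = "complex ^ ('n \<times> 'n \<times> 'n)"

definition alg_mult ::
    "'n::finite alg_structure \<Rightarrow> complex ^ 'n \<Rightarrow> complex ^ 'n \<Rightarrow> complex ^ 'n" where
  "alg_mult c x y = (\<chi> k. \<Sum>i\<in>UNIV. \<Sum>j\<in>UNIV. x $ i * y $ j * c $ (i, j, k))"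

definition novikov :: "'n::finite alg_structure \<Rightarrow> bool" where
  "novikov c \<longleftrightarrow> (\<forall>x y z.
     alg_mult c (alg_mult c x y) z = alg_mult c (alg_mult c x z) y \<and>
     alg_mult c (alg_mult c x y) z - alg_mult c x (alg_mult c y z) =
     alg_mult c (alg_mult c y x) z - alg_mult c y (alg_mult c x z))"

text \<open>\<open>bracketed_product c k x\<close>: \<open>x\<close> is a product of \<open>k\<close> elements under some bracketing.\<close>

inductive bracketed_product :: "'n::finite alg_structure \<Rightarrow> nat \<Rightarrow> complex ^ 'n \<Rightarrow> bool"
  for c where
  single: "bracketed_product c 1 x"
| mult: "bracketed_product c k x \<Longrightarrow> bracketed_product c l y \<Longrightarrow>
         bracketed_product c (k + l) (alg_mult c x y)"

definition nilpotent_alg :: "'n::finite alg_structure \<Rightarrow> bool" where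
  "nilpotent_alg c \<longleftrightarrow> (\<exists>k\<ge>1. \<forall>x. bracketed_product c k x \<longrightarrow> x = 0)"

definition nilpotent_novikov :: "'n::finite alg_structure set" where
  "nilpotent_novikov = {c. novikov c \<and> nilpotent_alg c}"

definition gl_act ::
    "complex ^ 'n ^ 'n \<Rightarrow> 'n::finite alg_structure \<Rightarrow> 'n alg_structure" where
  "gl_act g c = vec_lambda (\<lambda>(i, j, k).
     (g *v alg_mult c (matrix_inv g *v axis i 1) (matrix_inv g *v axis j 1)) $ k)"

definition gl_orbit :: "'n::finite alg_structure \<Rightarrow> 'n alg_structure set" where
  "gl_orbit c = {gl_act g c | g. invertible g}"

lemma alg_mult_axis:
  "alg_mult c (axis i 1) (axis j 1) = (\<chi> k. c $ (i, j, k))"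
proof -
  have "(\<Sum>a\<in>UNIV. \<Sum>b\<in>UNIV. axis i 1 $ a * axis j 1 $ b * c $ (a, b, k)) =
        (\<Sum>a\<in>UNIV. if a = i then \<Sum>b\<in>UNIV. if b = j then c $ (a, b, k) else 0 else 0)" for k
    by (intro sum.cong refl) (simp add: axis_def if_distrib[of "\<lambda>t. t * _"] cong: if_cong)
  then show ?thesis by (simp add: alg_mult_def sum.delta)
qed

lemma alg_mult_sum_left: "alg_mult c (\<Sum>i\<in>I. a i *s u i) y = (\<Sum>i\<in>I. a i *s alg_mult c (u i) y)"
proof (induction I rule: infinite_finite_induct)
  case (insert i I)
  have "alg_mult c (a i *s u i + w) y = a i *s alg_mult c (u i) y + alg_mult c w y" for w
    by (simp add: alg_mult_def vec_eq_iff sum.distrib sum_distrib_left algebra_simps)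
  then show ?case using insert by simp
qed (simp_all add: alg_mult_def vec_eq_iff)

lemma alg_mult_sum_right: "alg_mult c x (\<Sum>i\<in>I. a i *s u i) = (\<Sum>i\<in>I. a i *s alg_mult c x (u i))"
proof (induction I rule: infinite_finite_induct)
  case (insert i I)
  have "alg_mult c x (a i *s u i + w) = a i *s alg_mult c x (u i) + alg_mult c x w" for w
    by (simp add: alg_mult_def vec_eq_iff sum.distrib sum_distrib_left algebra_simps)
  then show ?case using insert by simp
qed (simp_all add: alg_mult_def vec_eq_iff)

lemma alg_mult_gl_act:
  "alg_mult (gl_act g c) x y = g *v alg_mult c (matrix_inv g *v x) (matrix_inv g *v y)"
proof -
  let ?h = "matrix_inv g"
  have lin: "A *v (\<Sum>i\<in>UNIV. a i *s u i) = (\<Sum>i\<in>UNIV. a i *s (A *v u i))"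
    for A :: "complex ^ 'a ^ 'a" and a u
    by (simp add: vec.sum vec.scale)
  have h: "?h *v z = (\<Sum>i\<in>UNIV. z $ i *s (?h *v axis i 1))" for z
    using lin[of ?h "\<lambda>i. z $ i" "\<lambda>i. axis i 1"] by (simp add: basis_expansion)
  have "g *v alg_mult c (?h *v x) (?h *v y) =
        g *v alg_mult c (\<Sum>i\<in>UNIV. x $ i *s (?h *v axis i 1)) (\<Sum>j\<in>UNIV. y $ j *s (?h *v axis j 1))"
    by (simp only: h[of x] h[of y])
  also have "\<dots> = (\<Sum>i\<in>UNIV. x $ i *s (\<Sum>j\<in>UNIV. y $ j *s
                 (g *v alg_mult c (?h *v axis i 1) (?h *v axis j 1))))"
    unfolding alg_mult_sum_left by (simp only: alg_mult_sum_right lin)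
  also have "\<dots> = alg_mult (gl_act g c) x y"
    unfolding gl_act_def alg_mult_def[of "vec_lambda _"]
    by (simp add: vec_eq_iff sum_distrib_left mult.assoc)
  finally show ?thesis by simp
qed

section \<open>The two families\<close>

text \<open>
  \<open>axis (i, j, k) a\<close> is the structure whose only nonzero product of basis elements is
  \<open>e\<^sub>i e\<^sub>j = a e\<^sub>k\<close>.  In the index type \<open>4\<close> the numeral \<open>4\<close> denotes the element \<open>0\<close>, so
  \<open>1, 2, 3, 4\<close> are its four distinct elements.
\<close>

definition N20 :: "complex \<Rightarrow> 4 alg_structure" where
  "N20 \<alpha> = axis (1, 2, 3) 1 + axis (1, 1, 4) \<alpha> + axis (1, 3, 4) 1
          + axis (2, 2, 4) 1 + axis (2, 3, 4) 1 + axis (3, 2, 4) (- 1)"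

definition N22 :: "complex \<Rightarrow> 4 alg_structure" where
  "N22 l = axis (1, 1, 2) 1 + axis (1, 2, 3) 1 + axis (1, 3, 4) (2 - l)
          + axis (2, 1, 3) l + axis (2, 2, 4) l + axis (3, 1, 4) l"

end

theory Submission
  imports Defs "HOL-Computational_Algebra.Polynomial"
begin

text \<open>
  The proof computes in flag coordinates. In a nilpotent algebra every proper subset that contains
  0 can be enlarged by a vector whose products with everything fall back into it
  (\<open>nilpotent_enlarge\<close>). Hence a four-dimensional nilpotent algebra has a basis with \<open>e\<^sub>i e\<^sub>j\<close> in
  the span of the \<open>e\<^sub>k\<close> with \<open>k > max i j\<close>: its structure is conjugate to one of the structures
  \<open>tri \<dots>\<close>, which have fourteen free parameters (\<open>nilpotent_imp_triangular\<close>). All ninefold products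
  vanish in such an algebra, so nilpotency is a polynomial condition and the variety is closed in
  the affine space.

  On these fourteen parameters the Novikov identities become a few quadratic equations
  (\<open>novikov_tri\<close>). After changes of the flag there remain two kinds of solutions
  (\<open>novikov_tri_in_closures\<close>).

  If \<open>e\<^sub>1 e\<^sub>1\<close> has an \<open>e\<^sub>2\<close>-component and \<open>e\<^sub>3 e\<^sub>3 = 0\<close>, one may take \<open>e\<^sub>1 e\<^sub>1\<close> as \<open>e\<^sub>2\<close>, and the
  equations say that two pairs of parameters are proportional. This quadric cone is parametrised
  by polynomials, and a generic point of it is isomorphic to a member of the second family.

  Otherwise the flag can be chosen such that \<open>e\<^sub>3 e\<^sub>3 = 0\<close> and all products lie in the span of
  \<open>e\<^sub>3, e\<^sub>4\<close>. The \<open>e\<^sub>3\<close>-component of the product is then a bilinear form \<open>B\<close> on the plane \<open>e\<^sub>1, e\<^sub>2\<close>,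
  and multiplication by \<open>e\<^sub>3\<close> from the left and from the right is given by two linear forms \<open>r\<close> and
  \<open>l\<close> with values in the line of \<open>e\<^sub>4\<close>. If \<open>r \<noteq> 0\<close>, the equations force \<open>B = s \<otimes> r\<close>, and
  \<open>r + l = t s\<close> unless \<open>s = 0\<close>. A generic choice of \<open>s, r, t\<close> gives a member of the first family
  up to isomorphism, and the remaining solutions are limits of such ones.

  Zariski closed sets are closed in the usual topology, so limits stay in the orbit closures; thus
  the two closures cover the variety. Each is irreducible, because two points of a polynomial
  family of orbits are joined by a rational curve inside it. Neither contains the other: the
  identity \<open>x (y (z w)) = 0\<close> separates the first family from the second. In the other direction
  one forms, by polynomials in the structure constants, a vector from double commutators; for the
  second family, but not for the first, its square annihilates everything from the left. Two
  closed irreducible sets which cover a space and are not nested are its irreducible components.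
\<close>

section \<open>Irreducible sets and the Zariski topology\<close>

lemma irreducible_components_of_union:
  assumes "closedin X C" "closedin X D" "irreducible_in X C" "irreducible_in X D"
    and union: "topspace X = C \<union> D" and nle: "\<not> C \<subseteq> D" "\<not> D \<subseteq> C"
  shows "irreducible_components X = {C, D}"
proof -
  have split: "E \<subseteq> C \<or> E \<subseteq> D" if "irreducible_in X E" for E
    using that assms(1,2) union unfolding irreducible_in_def by blast
  have "C \<in> irreducible_components X" "D \<in> irreducible_components X"
    using split assms unfolding irreducible_components_def by blast+
  moreover have "E = C \<or> E = D" if "E \<in> irreducible_components X" for E
    using that split[of E] assms(1-4) unfolding irreducible_components_def by blast
  ultimately show ?thesis by blast
qed

lemma irreducible_in_closure_of:
  assumes "irreducible_in X S"
  shows "irreducible_in X (X closure_of S)"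
proof -
  have S: "S \<subseteq> topspace X" using assms unfolding irreducible_in_def by blast
  have sub: "S \<subseteq> X closure_of S" using S by (rule closure_of_subset)
  have "X closure_of S \<subseteq> A \<or> X closure_of S \<subseteq> B"
    if "closedin X A" "closedin X B" "X closure_of S \<subseteq> A \<union> B" for A B
  proof -
    have "S \<subseteq> A \<or> S \<subseteq> B"
      using assms that sub unfolding irreducible_in_def by blast
    then show ?thesis using that by (metis closure_of_minimal)
  qed
  moreover have "X closure_of S \<noteq> {}"
    using assms sub unfolding irreducible_in_def by auto
  ultimately show ?thesis
    unfolding irreducible_in_def using closure_of_subset_topspace[of X S] by simp
qed

lemma irreducible_in_subtopology:
  assumes "irreducible_in X S" "S \<subseteq> T" "closedin X T"
  shows "irreducible_in (subtopology X T) S"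
  using assms closedin_subset[of X T] unfolding irreducible_in_def
  by (auto simp: closedin_closed_subtopology)

lemma polynomial_fun_sum:
  "(\<And>i. i \<in> I \<Longrightarrow> polynomial_fun (p i)) \<Longrightarrow> polynomial_fun (\<lambda>x. \<Sum>i\<in>I. p i x)"
  by (induction I rule: infinite_finite_induct) (auto intro: polynomial_fun.intros)

lemma polynomial_fun_diff:
  assumes "polynomial_fun p" "polynomial_fun q"
  shows "polynomial_fun (\<lambda>x. p x - q x)"
proof -
  have "polynomial_fun (\<lambda>x. p x + (- 1) * q x)"
    by (intro polynomial_fun.intros assms)
  then show ?thesis by simp
qed

lemma polynomial_fun_compose:
  assumes "polynomial_fun p" and "\<And>i. polynomial_fun (\<lambda>x. F x $ i)"
  shows "polynomial_fun (\<lambda>x. p (F x))"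
  using assms(1)
  by (induction rule: polynomial_fun.induct) (auto intro: polynomial_fun.intros assms(2))

lemma continuous_on_polynomial_fun: "polynomial_fun p \<Longrightarrow> continuous_on UNIV p"
  by (induction rule: polynomial_fun.induct) (auto intro!: continuous_intros)

lemma algebraic_setI:
  assumes "\<And>p. p \<in> P \<Longrightarrow> polynomial_fun p" "S = {x. \<forall>p\<in>P. p x = 0}"
  shows "algebraic_set S"
  using assms unfolding algebraic_set_def zero_locus_def by blast

lemma algebraic_set_common_zeros:
  assumes "\<And>i. polynomial_fun (p i)"
  shows "algebraic_set {x. \<forall>i. p i x = 0}"
  by (rule algebraic_setI[of "range p"]) (use assms in auto)

lemma algebraic_set_preimage:
  assumes "algebraic_set S" and F: "\<And>i. polynomial_fun (\<lambda>x. F x $ i)"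
  shows "algebraic_set {x. F x \<in> S}"
proof -
  obtain P where P: "\<And>p. p \<in> P \<Longrightarrow> polynomial_fun p" "S = {x. \<forall>p\<in>P. p x = 0}"
    using assms(1) unfolding algebraic_set_def zero_locus_def by blast
  show ?thesis
    by (rule algebraic_setI[of "(\<lambda>p x. p (F x)) ` P"])
      (use P in \<open>auto intro: polynomial_fun_compose F\<close>)
qed

lemma closed_algebraic_set:
  assumes "algebraic_set S" shows "closed S"
proof -
  obtain P where P: "\<And>p. p \<in> P \<Longrightarrow> polynomial_fun p" "S = {x. \<forall>p\<in>P. p x = 0}"
    using assms unfolding algebraic_set_def zero_locus_def by blast
  have "S = (\<Inter>p\<in>P. {x. p x = 0})" using P(2) by auto
  moreover have "closed {x. p x = 0}" if "p \<in> P" for p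
    using continuous_on_polynomial_fun[OF P(1)[OF that]]
    by (intro closed_Collect_eq continuous_on_const)
  ultimately show ?thesis by auto
qed

text \<open>
  Polynomials are continuous, so Zariski closed sets are closed in the usual topology.
\<close>

lemma limit_in_zariski_closure:
  assumes "(\<gamma> \<longlongrightarrow> x) F" "F \<noteq> bot" "eventually (\<lambda>t. \<gamma> t \<in> zariski closure_of S) F"
  shows "x \<in> zariski closure_of S"
proof -
  have "closed (zariski closure_of S)"
    by (intro closed_algebraic_set) (simp flip: closedin_zariski)
  then show ?thesis using Lim_in_closed_set[OF _ assms(3,2,1)] by blast
qed

text \<open>
  The form in which degenerations are used: a curve that lies in the closure, apart from finitely
  many parameters, has its limit there as well. The parameter 0 itself may be exceptional, so that
  the curve may contain negative powers of the parameter.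
\<close>

lemma in_zariski_closure_by_limit:
  fixes \<gamma> :: "complex \<Rightarrow> complex ^ 'n"
  assumes "(\<gamma> \<longlongrightarrow> x) (at 0)" "finite B" "\<And>t. t \<noteq> 0 \<Longrightarrow> t \<notin> B \<Longrightarrow> \<gamma> t \<in> zariski closure_of S"
  shows "x \<in> zariski closure_of S"
proof (rule limit_in_zariski_closure[OF assms(1)])
  have "open (- (B - {0}))" using assms(2) by (intro open_Compl finite_imp_closed) simp
  then have "eventually (\<lambda>t. t \<in> - (B - {0})) (at 0)"
    by (intro eventually_at_in_open') auto
  moreover have "eventually (\<lambda>t::complex. t \<noteq> 0) (at 0)"
    by (simp add: eventually_at_filter)
  ultimately show "eventually (\<lambda>t. \<gamma> t \<in> zariski closure_of S) (at 0)"
    by eventually_elim (use assms(3) in auto)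
qed auto

text \<open>
  Along a curve with common denominator \<open>D\<close> a polynomial function becomes a polynomial in the
  parameter after multiplication by a power of \<open>D\<close>; as a sum needs a common denominator, the
  exponent depends on the function.
\<close>

lemma polynomial_fun_on_rational_curve:
  assumes "polynomial_fun p"
    and \<gamma>: "\<And>t i. poly D t \<noteq> 0 \<Longrightarrow> \<gamma> t $ i * poly D t = poly (F i) t"
  shows "\<exists>n Q. \<forall>t. poly D t \<noteq> 0 \<longrightarrow> p (\<gamma> t) * poly D t ^ n = poly Q t"
  using assms(1)
proof (induction rule: polynomial_fun.induct)
  case (const a)
  have "\<forall>t. poly D t \<noteq> 0 \<longrightarrow> a * poly D t ^ 0 = poly [:a:] t" by simp
  then show ?case by blast
next
  case (coord i)
  have "\<forall>t. poly D t \<noteq> 0 \<longrightarrow> \<gamma> t $ i * poly D t ^ 1 = poly (F i) t" using \<gamma> by simp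
  then show ?case by blast
next
  case (add p q)
  then obtain n P m Q where
    "\<forall>t. poly D t \<noteq> 0 \<longrightarrow> p (\<gamma> t) * poly D t ^ n = poly P t"
    "\<forall>t. poly D t \<noteq> 0 \<longrightarrow> q (\<gamma> t) * poly D t ^ m = poly Q t" by blast
  then have "\<forall>t. poly D t \<noteq> 0 \<longrightarrow>
    (p (\<gamma> t) + q (\<gamma> t)) * poly D t ^ (n + m) = poly (P * D ^ m + Q * D ^ n) t"
    by (simp add: power_add algebra_simps)
  then show ?case by blast
next
  case (mult p q)
  then obtain n P m Q where
    "\<forall>t. poly D t \<noteq> 0 \<longrightarrow> p (\<gamma> t) * poly D t ^ n = poly P t"
    "\<forall>t. poly D t \<noteq> 0 \<longrightarrow> q (\<gamma> t) * poly D t ^ m = poly Q t" by blast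
  then have PQ: "poly P t = p (\<gamma> t) * poly D t ^ n" "poly Q t = q (\<gamma> t) * poly D t ^ m"
    if "poly D t \<noteq> 0" for t using that by simp_all
  have "\<forall>t. poly D t \<noteq> 0 \<longrightarrow>
    p (\<gamma> t) * q (\<gamma> t) * poly D t ^ (n + m) = poly (P * Q) t"
    by (simp add: PQ power_add)
  then show ?case by blast
qed

text \<open>
  Suppose two closed sets cover \<open>S\<close>, and each misses a point of it. An equation of the first and
  an equation of the second are nonzero at one end of a rational curve joining these points, but
  their product vanishes along the curve. Since polynomials in one variable have no zero divisors,
  this is impossible.
\<close>

lemma irreducible_if_joined_by_rational_curves:
  fixes S :: "(complex ^ 'n) set"
  assumes "S \<noteq> {}"
    and joined: "\<And>x y. x \<in> S \<Longrightarrow> y \<in> S \<Longrightarrow>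
      \<exists>\<gamma> D F. poly D 0 \<noteq> 0 \<and> poly D 1 \<noteq> 0 \<and> \<gamma> 0 = x \<and> \<gamma> 1 = y \<and>
        (\<forall>t. poly D t \<noteq> 0 \<longrightarrow> \<gamma> t \<in> S \<and> (\<forall>i. \<gamma> t $ i * poly D t = poly (F i) t))"
  shows "irreducible_in zariski S"
proof -
  have "S \<subseteq> A \<or> S \<subseteq> B"
    if A: "algebraic_set A" and B: "algebraic_set B" and sub: "S \<subseteq> A \<union> B" for A B
  proof (rule ccontr)
    assume "\<not> (S \<subseteq> A \<or> S \<subseteq> B)"
    then obtain x y where xy: "x \<in> S" "x \<notin> A" "y \<in> S" "y \<notin> B" by blast
    obtain p where p: "polynomial_fun p" "p x \<noteq> 0" "\<And>z. z \<in> A \<Longrightarrow> p z = 0"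
      using A xy(2) unfolding algebraic_set_def zero_locus_def by blast
    obtain q where q: "polynomial_fun q" "q y \<noteq> 0" "\<And>z. z \<in> B \<Longrightarrow> q z = 0"
      using B xy(4) unfolding algebraic_set_def zero_locus_def by blast
    obtain \<gamma> D F where D: "poly D 0 \<noteq> 0" "poly D 1 \<noteq> 0" and ends: "\<gamma> 0 = x" "\<gamma> 1 = y"
      and in_S: "\<And>t. poly D t \<noteq> 0 \<Longrightarrow> \<gamma> t \<in> S"
      and F: "\<And>t i. poly D t \<noteq> 0 \<Longrightarrow> \<gamma> t $ i * poly D t = poly (F i) t"
      using joined[OF xy(1,3)] by blast
    obtain n P where P: "\<And>t. poly D t \<noteq> 0 \<Longrightarrow> p (\<gamma> t) * poly D t ^ n = poly P t"
      using polynomial_fun_on_rational_curve[of p D \<gamma> F, OF p(1) F] by blast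
    obtain m Q where Q: "\<And>t. poly D t \<noteq> 0 \<Longrightarrow> q (\<gamma> t) * poly D t ^ m = poly Q t"
      using polynomial_fun_on_rational_curve[of q D \<gamma> F, OF q(1) F] by blast
    have "poly (P * Q * D) t = 0" for t
    proof (cases "poly D t = 0")
      case False
      then have "p (\<gamma> t) = 0 \<or> q (\<gamma> t) = 0" using in_S sub p(3) q(3) by blast
      then show ?thesis using P[OF False] Q[OF False] by auto
    qed simp
    then have "P * Q * D = 0" using poly_all_0_iff_0 by blast
    then have "P = 0 \<or> Q = 0 \<or> D = 0" by auto
    then show False using P[of 0] Q[of 1] D ends p(2) q(2) by auto
  qed
  then show ?thesis
    using assms(1) unfolding irreducible_in_def by (simp add: closedin_zariski)
qed

section \<open>Change of basis\<close>

lemma alg_mult_add_structure: "alg_mult (c + d) x y = alg_mult c x y + alg_mult d x y"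
  by (simp add: alg_mult_def vec_eq_iff sum.distrib algebra_simps)

lemma alg_mult_axis_structure:
  fixes x :: "complex ^ 'n::finite"
  shows "alg_mult (axis (i, j, k) a) x y = axis k (x $ i * y $ j * a)"
proof -
  have "(\<Sum>p\<in>UNIV. \<Sum>q\<in>UNIV. x $ p * y $ q * axis (i, j, k) a $ (p, q, m))
      = (\<Sum>p\<in>UNIV. if p = i then \<Sum>q\<in>UNIV. if q = j then x $ i * y $ j * axis k a $ m else 0 else 0)" for m
    by (intro sum.cong refl) (auto simp: axis_def if_distrib[of "(*) _"] cong: if_cong intro!: sum.neutral)
  also have "\<dots> m = x $ i * y $ j * axis k a $ m" for m by simp
  finally show ?thesis by (simp add: alg_mult_def vec_eq_iff) (simp add: axis_def)
qed

lemma alg_mult_add: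
  "alg_mult c (x + x') y = alg_mult c x y + alg_mult c x' y"
  "alg_mult c x (y + y') = alg_mult c x y + alg_mult c x y'"
  by (simp_all add: alg_mult_def vec_eq_iff sum.distrib algebra_simps)

lemma alg_mult_scale:
  "alg_mult c (a *s x) y = a *s alg_mult c x y"
  "alg_mult c x (a *s y) = a *s alg_mult c x y"
  by (simp_all add: alg_mult_def vec_eq_iff sum_distrib_left algebra_simps)

lemma matrix_inv_mult:
  fixes g :: "complex ^ 'n ^ 'n"
  assumes "invertible g"
  shows "g ** matrix_inv g = mat 1" "matrix_inv g ** g = mat 1"
    "g *v (matrix_inv g *v x) = x" "matrix_inv g *v (g *v x) = x"
proof -
  show g: "g ** matrix_inv g = mat 1" "matrix_inv g ** g = mat 1"
    using assms someI_ex[of "\<lambda>h. g ** h = mat 1 \<and> h ** g = mat 1"]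
    unfolding invertible_def matrix_inv_def by blast+
  show "g *v (matrix_inv g *v x) = x" "matrix_inv g *v (g *v x) = x"
    by (simp_all add: matrix_vector_mul_assoc g)
qed

text \<open>
  The structure constants are recovered from the products of basis vectors.
\<close>

lemma alg_structure_eqI:
  assumes "\<And>x y. alg_mult c x y = alg_mult d x y"
  shows "c = d"
proof -
  have "c $ (i, j, k) = d $ (i, j, k)" for i j k
    using assms[of "axis i 1" "axis j 1"] by (simp add: alg_mult_axis vec_eq_iff)
  then show ?thesis by (simp add: vec_eq_iff split_paired_all)
qed

lemma gl_act_eqI:
  assumes "invertible g" "\<And>x y. g *v alg_mult d x y = alg_mult c (g *v x) (g *v y)"
  shows "gl_act g d = c"
  by (rule alg_structure_eqI) (simp add: alg_mult_gl_act assms matrix_inv_mult)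

lemma gl_act_mult:
  assumes "invertible g" "invertible h"
  shows "gl_act (g ** h) c = gl_act g (gl_act h c)"
  by (rule gl_act_eqI)
    (simp_all add: assms invertible_mult alg_mult_gl_act matrix_inv_mult
       flip: matrix_vector_mul_assoc)

lemma gl_act_one: "gl_act (mat 1) c = c"
  by (rule gl_act_eqI) (simp_all add: invertible_def exI[of _ "mat 1"])

lemma invertible_matrix_inv:
  fixes g :: "complex ^ 'n ^ 'n"
  shows "invertible g \<Longrightarrow> invertible (matrix_inv g)"
  using matrix_inv_mult(1,2) unfolding invertible_def by blast

lemma gl_act_inv:
  assumes "invertible g" "gl_act g d = c"
  shows "gl_act (matrix_inv g) c = d"
  using assms gl_act_mult[of "matrix_inv g" g d]
  by (simp add: invertible_matrix_inv matrix_inv_mult gl_act_one)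

lemma in_gl_orbit: "c \<in> gl_orbit c"
  unfolding gl_orbit_def using gl_act_one[of c]
  by (metis (mono_tags, lifting) mem_Collect_eq invertible_def matrix_mul_lid)

text \<open>Every group element acts by polynomials, hence maps the closure of a stable set into itself.\<close>

lemma gl_act_in_orbit_closure:
  assumes "c \<in> zariski closure_of (\<Union>i. gl_orbit (f i))" "invertible g"
  shows "gl_act g c \<in> zariski closure_of (\<Union>i. gl_orbit (f i))" (is "_ \<in> ?C")
proof -
  have "polynomial_fun (\<lambda>c. alg_mult c x y $ k)" for x y :: "complex ^ 'a" and k
    unfolding alg_mult_def by (auto intro!: polynomial_fun_sum intro: polynomial_fun.intros)
  then have "polynomial_fun (\<lambda>c. gl_act g c $ i)" for i
    unfolding gl_act_def matrix_vector_mult_def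
    by (cases i) (auto intro!: polynomial_fun_sum intro: polynomial_fun.intros)
  then have "algebraic_set {c. gl_act g c \<in> ?C}"
    by (intro algebraic_set_preimage) (simp flip: closedin_zariski)
  moreover have "(\<Union>i. gl_orbit (f i)) \<subseteq> {c. gl_act g c \<in> ?C}"
  proof -
    have "gl_act g ` (\<Union>i. gl_orbit (f i)) \<subseteq> (\<Union>i. gl_orbit (f i))"
      unfolding gl_orbit_def using assms(2) by (force simp flip: gl_act_mult simp: invertible_mult)
    also have "\<dots> \<subseteq> ?C" by (intro closure_of_subset) simp
    finally show ?thesis by auto
  qed
  ultimately show ?thesis
    using assms(1) closure_of_minimal[of _ "{c. gl_act g c \<in> ?C}" zariski]
    by (auto simp: closedin_zariski)
qed

section \<open>Irreducibility of families of orbits\<close>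

lemma det_polynomial_entries:
  "\<exists>Q. \<forall>t. det (\<chi> i j. poly (M i j :: complex poly) t) = poly Q t"
proof -
  let ?Q = "\<Sum>p\<in>{p. p permutes UNIV}. [:of_int (sign p):] * (\<Prod>i\<in>UNIV. M i (p i))"
  have "det (\<chi> i j. poly (M i j) t) = poly ?Q t" for t
    by (simp add: det_def poly_sum poly_prod)
  then show ?thesis by blast
qed

text \<open>
  Two points of the family arise from \<open>f a\<close> and \<open>f b\<close> by the inverses of two invertible matrices.
  Moving linearly from one of these matrices to the other and from \<open>a\<close> to \<open>b\<close> gives a curve in the
  family wherever the determinant does not vanish. Its coordinates are polynomials divided by this
  determinant, by Cramer's rule.
\<close>

lemma irreducible_union_of_orbits:
  fixes f :: "complex \<Rightarrow> 'n::finite alg_structure"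
  assumes f: "\<And>i. \<exists>q. \<forall>t. f t $ i = poly q t"
  shows "irreducible_in zariski (\<Union>a. gl_orbit (f a))"
proof (rule irreducible_if_joined_by_rational_curves)
  show "(\<Union>a. gl_orbit (f a)) \<noteq> {}" using in_gl_orbit by blast
next
  fix c d assume "c \<in> (\<Union>a. gl_orbit (f a))" "d \<in> (\<Union>a. gl_orbit (f a))"
  then obtain a b g h where c: "invertible g" "c = gl_act g (f a)"
    and d: "invertible h" "d = gl_act h (f b)"
    unfolding gl_orbit_def by blast
  let ?g = "matrix_inv g" let ?h = "matrix_inv h"
  have inv_inv: "matrix_inv (matrix_inv k) = k" if "invertible k" for k :: "complex ^ 'n ^ 'n"
    using matrix_inv_mult[OF that] matrix_inv_mult[OF invertible_matrix_inv[OF that]]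
    by (metis matrix_mul_assoc matrix_mul_lid matrix_mul_rid)
  define m where "m i j = [: ?g $ i $ j, ?h $ i $ j - ?g $ i $ j :]" for i j
  define M where "M t = (\<chi> i j. poly (m i j) t)" for t
  have M01: "M 0 = ?g" "M 1 = ?h" by (simp_all add: M_def m_def vec_eq_iff)
  obtain D where D: "\<And>t. det (M t) = poly D t"
    using det_polynomial_entries[of m] unfolding M_def by blast
  obtain q where q: "\<And>i t. f t $ i = poly (q i) t" using f by metis
  define r where "r = [:a, b - a:]"
  define \<gamma> where "\<gamma> t = gl_act (matrix_inv (M t)) (f (poly r t))" for t
  have inv_M: "invertible (M t)" if "poly D t \<noteq> 0" for t
    using that by (simp add: invertible_det_nz D)
  have "\<exists>F. \<forall>t. poly D t \<noteq> 0 \<longrightarrow> \<gamma> t $ (i, j, k) * poly D t = poly F t" for i j k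
  proof -
    have col: "(M t *v axis v 1) $ u = poly (m u v) t" for t u v
      by (simp add: matrix_vector_mult_def axis_def M_def if_distrib[of "(*) _"] cong: if_cong)
    define w where "w l = (\<Sum>u\<in>UNIV. \<Sum>v\<in>UNIV. m u i * m v j * pcompose (q (u, v, l)) r)" for l
    have w: "alg_mult (f (poly r t)) (M t *v axis i 1) (M t *v axis j 1) $ l = poly (w l) t" for t l
      by (simp add: alg_mult_def w_def poly_sum poly_pcompose q col)
    obtain F where F: "\<And>t. det (\<chi> u v. poly (if v = k then w u else m u v) t) = poly F t"
      using det_polynomial_entries[of "\<lambda>u v. if v = k then w u else m u v"] by blast
    have "\<gamma> t $ (i, j, k) * poly D t = poly F t" if "poly D t \<noteq> 0" for t
    proof -
      let ?b = "alg_mult (f (poly r t)) (M t *v axis i 1) (M t *v axis j 1)"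
      have "M t *v (matrix_inv (M t) *v ?b) = ?b" by (simp add: matrix_inv_mult inv_M that)
      then have "matrix_inv (M t) *v ?b =
          (\<chi> k. det (\<chi> u v. if v = k then ?b $ u else M t $ u $ v) / det (M t))"
        using that by (subst (asm) cramer) (auto simp: D)
      then have "(matrix_inv (M t) *v ?b) $ k * poly D t =
          det (\<chi> u v. if v = k then ?b $ u else M t $ u $ v)"
        using that by (simp add: D)
      also have "\<dots> = poly F t"
        unfolding F[symmetric] by (rule arg_cong[of _ _ det], simp add: vec_eq_iff w, simp add: M_def)
      finally show ?thesis
        unfolding \<gamma>_def gl_act_def by (simp add: inv_inv inv_M that)
    qed
    then show ?thesis by blast
  qed
  then have "\<exists>F. \<forall>t. poly D t \<noteq> 0 \<longrightarrow> \<gamma> t $ i * poly D t = poly F t" for i by (cases i) auto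
  then obtain F where F: "\<And>i t. poly D t \<noteq> 0 \<Longrightarrow> \<gamma> t $ i * poly D t = poly (F i) t" by metis
  have "\<gamma> t \<in> (\<Union>a. gl_orbit (f a))" if "poly D t \<noteq> 0" for t
    unfolding \<gamma>_def gl_orbit_def using inv_M[OF that] invertible_matrix_inv by blast
  moreover have "poly D 0 \<noteq> 0" "poly D 1 \<noteq> 0"
    using c d by (simp_all flip: D add: M01 invertible_matrix_inv flip: invertible_det_nz)
  moreover have "\<gamma> 0 = c" "\<gamma> 1 = d"
    by (simp_all add: \<gamma>_def M01 inv_inv c d r_def)
  ultimately show "\<exists>\<gamma> D F. poly D 0 \<noteq> 0 \<and> poly D 1 \<noteq> 0 \<and> \<gamma> 0 = c \<and> \<gamma> 1 = d \<and>
      (\<forall>t. poly D t \<noteq> 0 \<longrightarrow> \<gamma> t \<in> (\<Union>a. gl_orbit (f a)) \<and>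
        (\<forall>i. \<gamma> t $ i * poly D t = poly (F i) t))"
    using F by blast
qed

section \<open>Strictly triangular structures in dimension four\<close>

text \<open>
  The structures for which \<open>e\<^sub>i e\<^sub>j\<close> lies in the span of the \<open>e\<^sub>k\<close> with \<open>k > max i j\<close>: \<open>a\<close> is the
  coefficient of \<open>e\<^sub>2\<close> in \<open>e\<^sub>1 e\<^sub>1\<close>, \<open>b\<^sub>i\<^sub>j\<close> that of \<open>e\<^sub>3\<close> and \<open>m\<^sub>i\<^sub>j\<close> that of \<open>e\<^sub>4\<close> in \<open>e\<^sub>i e\<^sub>j\<close>.
\<close>

definition tri :: "complex \<Rightarrow> complex \<Rightarrow> complex \<Rightarrow> complex \<Rightarrow> complex \<Rightarrow>
    complex \<Rightarrow> complex \<Rightarrow> complex \<Rightarrow> complex \<Rightarrow> complex \<Rightarrow> complex \<Rightarrow>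
    complex \<Rightarrow> complex \<Rightarrow> complex \<Rightarrow> 4 alg_structure" where
  "tri a b\<^sub>1\<^sub>1 b\<^sub>1\<^sub>2 b\<^sub>2\<^sub>1 b\<^sub>2\<^sub>2 m\<^sub>1\<^sub>1 m\<^sub>1\<^sub>2 m\<^sub>1\<^sub>3 m\<^sub>2\<^sub>1 m\<^sub>2\<^sub>2 m\<^sub>2\<^sub>3 m\<^sub>3\<^sub>1 m\<^sub>3\<^sub>2 m\<^sub>3\<^sub>3 =
     axis (1, 1, 2) a + axis (1, 1, 3) b\<^sub>1\<^sub>1 + axis (1, 2, 3) b\<^sub>1\<^sub>2 + axis (2, 1, 3) b\<^sub>2\<^sub>1 + axis (2, 2, 3) b\<^sub>2\<^sub>2
     + axis (1, 1, 4) m\<^sub>1\<^sub>1 + axis (1, 2, 4) m\<^sub>1\<^sub>2 + axis (1, 3, 4) m\<^sub>1\<^sub>3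
     + axis (2, 1, 4) m\<^sub>2\<^sub>1 + axis (2, 2, 4) m\<^sub>2\<^sub>2 + axis (2, 3, 4) m\<^sub>2\<^sub>3
     + axis (3, 1, 4) m\<^sub>3\<^sub>1 + axis (3, 2, 4) m\<^sub>3\<^sub>2 + axis (3, 3, 4) m\<^sub>3\<^sub>3"

lemma alg_mult_tri [simp]:
  shows "alg_mult (tri a b\<^sub>1\<^sub>1 b\<^sub>1\<^sub>2 b\<^sub>2\<^sub>1 b\<^sub>2\<^sub>2 m\<^sub>1\<^sub>1 m\<^sub>1\<^sub>2 m\<^sub>1\<^sub>3 m\<^sub>2\<^sub>1 m\<^sub>2\<^sub>2 m\<^sub>2\<^sub>3 m\<^sub>3\<^sub>1 m\<^sub>3\<^sub>2 m\<^sub>3\<^sub>3) x y $ 1 = 0"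
    "alg_mult (tri a b\<^sub>1\<^sub>1 b\<^sub>1\<^sub>2 b\<^sub>2\<^sub>1 b\<^sub>2\<^sub>2 m\<^sub>1\<^sub>1 m\<^sub>1\<^sub>2 m\<^sub>1\<^sub>3 m\<^sub>2\<^sub>1 m\<^sub>2\<^sub>2 m\<^sub>2\<^sub>3 m\<^sub>3\<^sub>1 m\<^sub>3\<^sub>2 m\<^sub>3\<^sub>3) x y $ 2 = x $ 1 * y $ 1 * a"
    "alg_mult (tri a b\<^sub>1\<^sub>1 b\<^sub>1\<^sub>2 b\<^sub>2\<^sub>1 b\<^sub>2\<^sub>2 m\<^sub>1\<^sub>1 m\<^sub>1\<^sub>2 m\<^sub>1\<^sub>3 m\<^sub>2\<^sub>1 m\<^sub>2\<^sub>2 m\<^sub>2\<^sub>3 m\<^sub>3\<^sub>1 m\<^sub>3\<^sub>2 m\<^sub>3\<^sub>3) x y $ 3 = x $ 1 * y $ 1 * b\<^sub>1\<^sub>1 + x $ 1 * y $ 2 * b\<^sub>1\<^sub>2 + x $ 2 * y $ 1 * b\<^sub>2\<^sub>1 + x $ 2 * y $ 2 * b\<^sub>2\<^sub>2"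
    "alg_mult (tri a b\<^sub>1\<^sub>1 b\<^sub>1\<^sub>2 b\<^sub>2\<^sub>1 b\<^sub>2\<^sub>2 m\<^sub>1\<^sub>1 m\<^sub>1\<^sub>2 m\<^sub>1\<^sub>3 m\<^sub>2\<^sub>1 m\<^sub>2\<^sub>2 m\<^sub>2\<^sub>3 m\<^sub>3\<^sub>1 m\<^sub>3\<^sub>2 m\<^sub>3\<^sub>3) x y $ 4 =
       x $ 1 * y $ 1 * m\<^sub>1\<^sub>1 + x $ 1 * y $ 2 * m\<^sub>1\<^sub>2 + x $ 1 * y $ 3 * m\<^sub>1\<^sub>3 +
       x $ 2 * y $ 1 * m\<^sub>2\<^sub>1 + x $ 2 * y $ 2 * m\<^sub>2\<^sub>2 + x $ 2 * y $ 3 * m\<^sub>2\<^sub>3 +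
       x $ 3 * y $ 1 * m\<^sub>3\<^sub>1 + x $ 3 * y $ 2 * m\<^sub>3\<^sub>2 + x $ 3 * y $ 3 * m\<^sub>3\<^sub>3"
  unfolding tri_def alg_mult_add_structure alg_mult_axis_structure
  by (simp_all add: axis_def)

lemma axis_zero [simp]: "axis i 0 = 0"
  by (simp add: axis_def vec_eq_iff)

lemma N20_eq_tri: "N20 \<alpha> = tri 0 0 1 0 0 \<alpha> 0 1 0 1 1 0 (- 1) 0"
  by (simp add: N20_def tri_def)

lemma N22_eq_tri: "N22 l = tri 1 0 1 l 0 0 0 (2 - l) 0 l 0 l 0 0"
  by (simp add: N22_def tri_def)

lemma tendsto_tri [tendsto_intros]:
  assumes "(a \<longlongrightarrow> a') F" "(b\<^sub>1\<^sub>1 \<longlongrightarrow> b\<^sub>1\<^sub>1') F" "(b\<^sub>1\<^sub>2 \<longlongrightarrow> b\<^sub>1\<^sub>2') F" "(b\<^sub>2\<^sub>1 \<longlongrightarrow> b\<^sub>2\<^sub>1') F" "(b\<^sub>2\<^sub>2 \<longlongrightarrow> b\<^sub>2\<^sub>2') F"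
    "(m\<^sub>1\<^sub>1 \<longlongrightarrow> m\<^sub>1\<^sub>1') F" "(m\<^sub>1\<^sub>2 \<longlongrightarrow> m\<^sub>1\<^sub>2') F" "(m\<^sub>1\<^sub>3 \<longlongrightarrow> m\<^sub>1\<^sub>3') F"
    "(m\<^sub>2\<^sub>1 \<longlongrightarrow> m\<^sub>2\<^sub>1') F" "(m\<^sub>2\<^sub>2 \<longlongrightarrow> m\<^sub>2\<^sub>2') F" "(m\<^sub>2\<^sub>3 \<longlongrightarrow> m\<^sub>2\<^sub>3') F"
    "(m\<^sub>3\<^sub>1 \<longlongrightarrow> m\<^sub>3\<^sub>1') F" "(m\<^sub>3\<^sub>2 \<longlongrightarrow> m\<^sub>3\<^sub>2') F" "(m\<^sub>3\<^sub>3 \<longlongrightarrow> m\<^sub>3\<^sub>3') F"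
  shows "((\<lambda>t. tri (a t) (b\<^sub>1\<^sub>1 t) (b\<^sub>1\<^sub>2 t) (b\<^sub>2\<^sub>1 t) (b\<^sub>2\<^sub>2 t) (m\<^sub>1\<^sub>1 t) (m\<^sub>1\<^sub>2 t) (m\<^sub>1\<^sub>3 t)
      (m\<^sub>2\<^sub>1 t) (m\<^sub>2\<^sub>2 t) (m\<^sub>2\<^sub>3 t) (m\<^sub>3\<^sub>1 t) (m\<^sub>3\<^sub>2 t) (m\<^sub>3\<^sub>3 t)) \<longlongrightarrow>
    tri a' b\<^sub>1\<^sub>1' b\<^sub>1\<^sub>2' b\<^sub>2\<^sub>1' b\<^sub>2\<^sub>2' m\<^sub>1\<^sub>1' m\<^sub>1\<^sub>2' m\<^sub>1\<^sub>3' m\<^sub>2\<^sub>1' m\<^sub>2\<^sub>2' m\<^sub>2\<^sub>3' m\<^sub>3\<^sub>1' m\<^sub>3\<^sub>2' m\<^sub>3\<^sub>3') F"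
proof -
  have *: "((\<lambda>t. axis i (h t)) \<longlongrightarrow> axis i h') F" if "(h \<longlongrightarrow> h') F" for i :: "4 \<times> 4 \<times> 4" and h h'
    by (rule vec_tendstoI) (simp add: axis_def that)
  then show ?thesis unfolding tri_def by (intro tendsto_add * assms)
qed

definition from_cols :: "complex ^ 4 \<Rightarrow> complex ^ 4 \<Rightarrow> complex ^ 4 \<Rightarrow> complex ^ 4 \<Rightarrow> complex ^ 4 ^ 4" where
  "from_cols u\<^sub>1 u\<^sub>2 u\<^sub>3 u\<^sub>4 = (\<chi> i j. (if j = 1 then u\<^sub>1 else if j = 2 then u\<^sub>2 else if j = 3 then u\<^sub>3 else u\<^sub>4) $ i)"

lemma from_cols_mult:
  "from_cols u\<^sub>1 u\<^sub>2 u\<^sub>3 u\<^sub>4 *v x = x $ 1 *s u\<^sub>1 + x $ 2 *s u\<^sub>2 + x $ 3 *s u\<^sub>3 + x $ 4 *s u\<^sub>4"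
  by (simp add: from_cols_def matrix_vector_mult_def vec_eq_iff sum_4 mult.commute)

lemma vec_eq_4: "(x :: complex ^ 4) = y \<longleftrightarrow> x $ 1 = y $ 1 \<and> x $ 2 = y $ 2 \<and> x $ 3 = y $ 3 \<and> x $ 4 = y $ 4"
  by (simp add: vec_eq_iff forall_4)

lemma invertible_if_ker:
  fixes g :: "complex ^ 4 ^ 4"
  assumes "\<And>x. g *v x = 0 \<Longrightarrow> x $ 1 = 0 \<and> x $ 2 = 0 \<and> x $ 3 = 0 \<and> x $ 4 = 0"
  shows "invertible g"
proof -
  have "x = 0" if "g *v x = 0" for x using assms[OF that] by (simp add: vec_eq_4)
  then show ?thesis unfolding invertible_left_inverse matrix_left_invertible_ker by blast
qed

section \<open>Nilpotency\<close>

text \<open>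
  A formal product: its value is a function of the structure constants, so one may ask whether it
  is polynomial in them. The predicate \<open>bracketed_product\<close> has the structure fixed instead.
\<close>

datatype 'a bracketing = Factor 'a | Times "'a bracketing" "'a bracketing"

primrec factors :: "'a bracketing \<Rightarrow> nat" where
  "factors (Factor x) = 1"
| "factors (Times s t) = factors s + factors t"

primrec multiply_out :: "'n::finite alg_structure \<Rightarrow> (complex ^ 'n) bracketing \<Rightarrow> complex ^ 'n" where
  "multiply_out c (Factor x) = x"
| "multiply_out c (Times s t) = alg_mult c (multiply_out c s) (multiply_out c t)"

lemma bracketed_product_iff: "bracketed_product c k x \<longleftrightarrow> (\<exists>s. factors s = k \<and> multiply_out c s = x)"
proof
  assume "bracketed_product c k x"
  then show "\<exists>s. factors s = k \<and> multiply_out c s = x"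
  proof induction
    case (single x)
    show ?case by (intro exI[of _ "Factor x"]) simp
  next
    case (mult k x l y)
    then obtain s t where "factors s = k" "multiply_out c s = x" "factors t = l" "multiply_out c t = y"
      by blast
    then show ?case by (intro exI[of _ "Times s t"]) simp
  qed
next
  have "bracketed_product c (factors s) (multiply_out c s)" for s
  proof (induction s)
    case (Factor x)
    show ?case using bracketed_product.single[of c x] by simp
  next
    case (Times s t)
    then show ?case using bracketed_product.mult[of c _ _ "factors t"] by simp
  qed
  moreover assume "\<exists>s. factors s = k \<and> multiply_out c s = x"
  ultimately show "bracketed_product c k x" by blast
qed

lemma polynomial_fun_alg_mult:
  assumes "\<And>i. polynomial_fun (\<lambda>c. F c $ i)" "\<And>i. polynomial_fun (\<lambda>c. G c $ i)"
  shows "polynomial_fun (\<lambda>c. alg_mult c (F c) (G c) $ k)"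
  unfolding alg_mult_def vec_lambda_beta
  by (intro polynomial_fun_sum polynomial_fun.mult polynomial_fun.coord assms)

lemma polynomial_fun_multiply_out: "polynomial_fun (\<lambda>c. multiply_out c s $ i)"
  by (induction s arbitrary: i) (auto intro: polynomial_fun_alg_mult polynomial_fun.intros)

lemma bracketed_product_pos: "bracketed_product c k x \<Longrightarrow> 1 \<le> k"
  by (induction rule: bracketed_product.induct) auto

text \<open>
  Two factors that are multiplied with each other first can be regarded as one factor.
\<close>

lemma bracketed_product_pred:
  assumes "bracketed_product c k x" "2 \<le> k"
  shows "bracketed_product c (k - 1) x"
  using assms
proof (induction)
  case (mult k x l y)
  have pos: "k \<ge> 1" "l \<ge> 1" using mult(1,2) bracketed_product_pos by blast+
  consider "2 \<le> k" | "2 \<le> l" | "k = 1" "l = 1" using pos by linarith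
  then show ?case
  proof cases
    case 1
    then have "bracketed_product c (k - 1 + l) (alg_mult c x y)"
      using mult by (intro bracketed_product.mult)
    then show ?thesis using 1 by simp
  next
    case 2
    then have "bracketed_product c (k + (l - 1)) (alg_mult c x y)"
      using mult by (intro bracketed_product.mult)
    then show ?thesis using 2 by simp
  next
    case 3
    then show ?thesis using bracketed_product.single by simp
  qed
qed simp

lemma bracketed_product_mono:
  assumes "bracketed_product c k x" "1 \<le> l" "l \<le> k"
  shows "bracketed_product c l x"
  using assms(3,1)
proof (induction k rule: dec_induct)
  case (step n)
  then show ?case using bracketed_product_pred[of c "Suc n" x] assms(2) by simp
qed

text \<open>
  Among the products that are not in \<open>W\<close> take one with the largest number of factors. This number
  is bounded by nilpotency, as longer products can be read as shorter ones.
\<close>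

lemma nilpotent_enlarge:
  assumes "nilpotent_alg c" "W \<noteq> UNIV" "0 \<in> W"
  shows "\<exists>x. x \<notin> W \<and> (\<forall>y. alg_mult c x y \<in> W \<and> alg_mult c y x \<in> W)"
proof -
  obtain n where n: "n \<ge> 1" "\<And>x. bracketed_product c n x \<Longrightarrow> x = 0"
    using assms(1) unfolding nilpotent_alg_def by blast
  define K where "K = {k. \<exists>x. x \<notin> W \<and> bracketed_product c k x}"
  have "k < n" if "k \<in> K" for k
  proof (rule ccontr)
    assume "\<not> k < n"
    with that n assms(3) show False
      unfolding K_def using bracketed_product_mono[of c k _ n] by fastforce
  qed
  then have "finite K" by (meson finite_nat_set_iff_bounded)
  moreover have "K \<noteq> {}"
    using assms(2) bracketed_product.single unfolding K_def by blast
  ultimately have max: "Max K \<in> K" "\<And>k. k \<in> K \<Longrightarrow> k \<le> Max K" by auto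
  then obtain x where x: "x \<notin> W" "bracketed_product c (Max K) x" unfolding K_def by blast
  have "alg_mult c x y \<in> W \<and> alg_mult c y x \<in> W" for y
  proof -
    have "bracketed_product c (Max K + 1) (alg_mult c x y)"
      "bracketed_product c (1 + Max K) (alg_mult c y x)"
      by (intro bracketed_product.intros x(2))+
    moreover have "Max K + 1 \<notin> K" using max(2)[of "Max K + 1"] by auto
    ultimately show ?thesis unfolding K_def by auto
  qed
  with x(1) show ?thesis by blast
qed

text \<open>
  Enlarging the zero subspace four times, each time by a vector as in \<open>nilpotent_enlarge\<close>, gives
  the last vector of the new basis first.
\<close>

lemma nilpotent_imp_triangular:
  fixes c :: "4 alg_structure"
  assumes "nilpotent_alg c"
  shows "\<exists>g. invertible g \<and> (\<exists>a b\<^sub>1\<^sub>1 b\<^sub>1\<^sub>2 b\<^sub>2\<^sub>1 b\<^sub>2\<^sub>2 m\<^sub>1\<^sub>1 m\<^sub>1\<^sub>2 m\<^sub>1\<^sub>3 m\<^sub>2\<^sub>1 m\<^sub>2\<^sub>2 m\<^sub>2\<^sub>3 m\<^sub>3\<^sub>1 m\<^sub>3\<^sub>2 m\<^sub>3\<^sub>3.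
    c = gl_act g (tri a b\<^sub>1\<^sub>1 b\<^sub>1\<^sub>2 b\<^sub>2\<^sub>1 b\<^sub>2\<^sub>2 m\<^sub>1\<^sub>1 m\<^sub>1\<^sub>2 m\<^sub>1\<^sub>3 m\<^sub>2\<^sub>1 m\<^sub>2\<^sub>2 m\<^sub>2\<^sub>3 m\<^sub>3\<^sub>1 m\<^sub>3\<^sub>2 m\<^sub>3\<^sub>3))"
proof -
  have step: "\<exists>x. x \<notin> vec.span V \<and> (\<forall>y. alg_mult c x y \<in> vec.span V \<and> alg_mult c y x \<in> vec.span V)"
    if "finite V" "card V < 4" for V :: "(complex ^ 4) set"
  proof (rule nilpotent_enlarge[OF assms])
    have "vec.dim V \<le> card V" using that(1) by (rule vec.dim_le_card')
    show "vec.span V \<noteq> UNIV"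
    proof
      assume "vec.span V = UNIV"
      then have "vec.dim V = CARD(4)" by (metis vec.dim_span vec_dim_card)
      then show False using \<open>vec.dim V \<le> card V\<close> that(2) by simp
    qed
  qed (rule vec.span_zero)
  obtain e\<^sub>4 where e4: "e\<^sub>4 \<notin> vec.span {}" "\<And>y. alg_mult c e\<^sub>4 y \<in> vec.span {} \<and> alg_mult c y e\<^sub>4 \<in> vec.span {}"
    using step[of "{}"] by auto
  obtain e\<^sub>3 where e3: "e\<^sub>3 \<notin> vec.span {e\<^sub>4}" "\<And>y. alg_mult c e\<^sub>3 y \<in> vec.span {e\<^sub>4} \<and> alg_mult c y e\<^sub>3 \<in> vec.span {e\<^sub>4}"
    using step[of "{e\<^sub>4}"] by auto
  have "card {e\<^sub>3, e\<^sub>4} < 4" "card {e\<^sub>2, e\<^sub>3, e\<^sub>4} < 4" for e\<^sub>2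
    by (simp_all add: card_insert_if)
  then obtain e\<^sub>2 where e2: "e\<^sub>2 \<notin> vec.span {e\<^sub>3, e\<^sub>4}"
      "\<And>y. alg_mult c e\<^sub>2 y \<in> vec.span {e\<^sub>3, e\<^sub>4} \<and> alg_mult c y e\<^sub>2 \<in> vec.span {e\<^sub>3, e\<^sub>4}"
    using step[of "{e\<^sub>3, e\<^sub>4}"] by auto
  obtain e\<^sub>1 where e1: "e\<^sub>1 \<notin> vec.span {e\<^sub>2, e\<^sub>3, e\<^sub>4}"
      "\<And>y. alg_mult c e\<^sub>1 y \<in> vec.span {e\<^sub>2, e\<^sub>3, e\<^sub>4} \<and> alg_mult c y e\<^sub>1 \<in> vec.span {e\<^sub>2, e\<^sub>3, e\<^sub>4}"
    using step[of "{e\<^sub>2, e\<^sub>3, e\<^sub>4}"] \<open>card {e\<^sub>2, e\<^sub>3, e\<^sub>4} < 4\<close> by auto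
  define g where "g = from_cols e\<^sub>1 e\<^sub>2 e\<^sub>3 e\<^sub>4"
  note gx = from_cols_mult[of e\<^sub>1 e\<^sub>2 e\<^sub>3 e\<^sub>4, folded g_def]
  have scale: "r = 0" if "r *s e + w = 0" "e \<notin> vec.span V" "w \<in> vec.span V" for r e w V
  proof (rule ccontr)
    assume "r \<noteq> 0"
    have "r *s e = - w" using that(1) by (simp add: eq_neg_iff_add_eq_0)
    then have "r *s e \<in> vec.span V" using that(3) by (simp add: vec.span_neg)
    then have "inverse r *s (r *s e) \<in> vec.span V" by (rule vec.span_scale)
    then show False using \<open>r \<noteq> 0\<close> that(2) by simp
  qed
  have in_span: "r *s e\<^sub>4 \<in> vec.span {e\<^sub>4}" "r *s e\<^sub>3 + s *s e\<^sub>4 \<in> vec.span {e\<^sub>3, e\<^sub>4}"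
    "r *s e\<^sub>2 + (s *s e\<^sub>3 + t *s e\<^sub>4) \<in> vec.span {e\<^sub>2, e\<^sub>3, e\<^sub>4}" for r s t
    by (intro vec.span_add vec.span_scale vec.span_base; simp)+
  have inv: "invertible g"
  proof (rule invertible_if_ker)
    fix x assume 0: "g *v x = 0"
    then have "x $ 1 *s e\<^sub>1 + (x $ 2 *s e\<^sub>2 + (x $ 3 *s e\<^sub>3 + x $ 4 *s e\<^sub>4)) = 0"
      by (simp add: gx add.assoc)
    then have x1: "x $ 1 = 0" by (rule scale[OF _ e1(1) in_span(3)])
    then have "x $ 2 *s e\<^sub>2 + (x $ 3 *s e\<^sub>3 + x $ 4 *s e\<^sub>4) = 0"
      using 0 by (simp add: gx add.assoc)
    then have x2: "x $ 2 = 0" by (rule scale[OF _ e2(1) in_span(2)])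
    then have "x $ 3 *s e\<^sub>3 + x $ 4 *s e\<^sub>4 = 0"
      using 0 x1 by (simp add: gx)
    then have x3: "x $ 3 = 0" by (rule scale[OF _ e3(1) in_span(1)])
    then have "x $ 4 *s e\<^sub>4 + 0 = 0" using 0 x1 x2 by (simp add: gx)
    then have "x $ 4 = 0" by (rule scale[OF _ e4(1) vec.span_zero])
    with x1 x2 x3 show "x $ 1 = 0 \<and> x $ 2 = 0 \<and> x $ 3 = 0 \<and> x $ 4 = 0" by simp
  qed
  have inj: "z = z'" if "g *v z = g *v z'" for z z'
    using that matrix_inv_mult(4)[OF inv] by metis
  have span4: "z $ 1 = 0 \<and> z $ 2 = 0 \<and> z $ 3 = 0 \<and> z $ 4 = 0" if "g *v z \<in> vec.span {}" for z
    using inj[of z 0] that by (simp add: vec_eq_4)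
  have span3: "z $ 1 = 0 \<and> z $ 2 = 0 \<and> z $ 3 = 0" if z: "g *v z \<in> vec.span {e\<^sub>4}" for z
  proof -
    obtain r where eq: "g *v z = r *s e\<^sub>4" using z by (auto simp: vec.span_singleton)
    have "z = axis 4 r" by (rule inj[OF trans[OF eq]]) (simp add: gx axis_def)
    then show ?thesis by (simp add: axis_def)
  qed
  have span2: "z $ 1 = 0 \<and> z $ 2 = 0" if z: "g *v z \<in> vec.span {e\<^sub>3, e\<^sub>4}" for z
  proof -
    obtain s where "g *v z - s *s e\<^sub>3 \<in> vec.span {e\<^sub>4}"
      using z vec.span_insert[of e\<^sub>3 "{e\<^sub>4}"] by blast
    then obtain r where "g *v z - s *s e\<^sub>3 = r *s e\<^sub>4" by (auto simp: vec.span_singleton)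
    then have eq: "g *v z = s *s e\<^sub>3 + r *s e\<^sub>4" by (simp add: diff_eq_eq add.commute)
    have "z = axis 3 s + axis 4 r" by (rule inj[OF trans[OF eq]]) (simp add: gx axis_def)
    then show ?thesis by (simp add: axis_def)
  qed
  have span1: "z $ 1 = 0" if z: "g *v z \<in> vec.span {e\<^sub>2, e\<^sub>3, e\<^sub>4}" for z
  proof -
    obtain t where "g *v z - t *s e\<^sub>2 \<in> vec.span {e\<^sub>3, e\<^sub>4}"
      using z vec.span_insert[of e\<^sub>2 "{e\<^sub>3, e\<^sub>4}"] by blast
    then obtain s where "g *v z - t *s e\<^sub>2 - s *s e\<^sub>3 \<in> vec.span {e\<^sub>4}"
      using vec.span_insert[of e\<^sub>3 "{e\<^sub>4}"] by blast
    then obtain r where "g *v z - t *s e\<^sub>2 - s *s e\<^sub>3 = r *s e\<^sub>4"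
      by (auto simp: vec.span_singleton)
    then have eq: "g *v z = t *s e\<^sub>2 + s *s e\<^sub>3 + r *s e\<^sub>4" by (simp add: diff_eq_eq add_ac)
    have "z = axis 2 t + axis 3 s + axis 4 r" by (rule inj[OF trans[OF eq]]) (simp add: gx axis_def)
    then show ?thesis by (simp add: axis_def)
  qed
  define d where "d = gl_act (matrix_inv g) c"
  have c: "c = gl_act g d"
    using inv by (simp add: d_def gl_act_one flip: gl_act_mult add: invertible_matrix_inv matrix_inv_mult)
  have cols: "g *v axis 1 1 = e\<^sub>1" "g *v axis 2 1 = e\<^sub>2" "g *v axis 3 1 = e\<^sub>3" "g *v axis 4 1 = e\<^sub>4"
    by (simp_all add: gx axis_def)
  have d: "g *v (\<chi> k. d $ (i, j, k)) = alg_mult c (g *v axis i 1) (g *v axis j 1)" for i j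
    by (simp add: c alg_mult_gl_act matrix_inv_mult inv alg_mult_axis)
  have d1: "d $ (1, j, 1) = 0" "d $ (j, 1, 1) = 0" for j
    using span1[of "\<chi> k. d $ (1, j, k)"] span1[of "\<chi> k. d $ (j, 1, k)"] e1(2) by (simp_all add: d cols)
  have d2: "d $ (2, j, 1) = 0" "d $ (j, 2, 1) = 0" "d $ (2, j, 2) = 0" "d $ (j, 2, 2) = 0" for j
    using span2[of "\<chi> k. d $ (2, j, k)"] span2[of "\<chi> k. d $ (j, 2, k)"] e2(2) by (simp_all add: d cols)
  have d3: "d $ (3, j, 1) = 0" "d $ (j, 3, 1) = 0" "d $ (3, j, 2) = 0" "d $ (j, 3, 2) = 0"
      "d $ (3, j, 3) = 0" "d $ (j, 3, 3) = 0" for j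
    using span3[of "\<chi> k. d $ (3, j, k)"] span3[of "\<chi> k. d $ (j, 3, k)"] e3(2) by (simp_all add: d cols)
  have d4: "d $ (4, j, k) = 0" "d $ (j, 4, k) = 0" for j k
    using span4[of "\<chi> k. d $ (4, j, k)"] span4[of "\<chi> k. d $ (j, 4, k)"] e4(2) exhaust_4[of k]
    by (auto simp: d cols)
  have d_tri: "d = tri (d $ (1,1,2)) (d $ (1,1,3)) (d $ (1,2,3)) (d $ (2,1,3)) (d $ (2,2,3))
      (d $ (1,1,4)) (d $ (1,2,4)) (d $ (1,3,4)) (d $ (2,1,4)) (d $ (2,2,4)) (d $ (2,3,4))
      (d $ (3,1,4)) (d $ (3,2,4)) (d $ (3,3,4))"
    unfolding vec_eq_iff split_paired_all split_paired_All forall_4 tri_def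
    by (simp add: axis_def d1 d2 d3 d4)
  show ?thesis
    by (intro exI conjI, rule inv, rule trans[OF c arg_cong[OF d_tri, of "gl_act g"]])
qed

text \<open>
  Passing from one coordinate to the next doubles the bound: of the two factors of a product, one
  has at least half of the factors, and it is enough that the earlier coordinates of this one
  vanish.
\<close>

lemma bracketed_product_tri:
  assumes "bracketed_product (tri a b\<^sub>1\<^sub>1 b\<^sub>1\<^sub>2 b\<^sub>2\<^sub>1 b\<^sub>2\<^sub>2 m\<^sub>1\<^sub>1 m\<^sub>1\<^sub>2 m\<^sub>1\<^sub>3 m\<^sub>2\<^sub>1 m\<^sub>2\<^sub>2 m\<^sub>2\<^sub>3 m\<^sub>3\<^sub>1 m\<^sub>3\<^sub>2 m\<^sub>3\<^sub>3) k x"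
  shows "(1 < k \<longrightarrow> x $ 1 = 0) \<and> (2 < k \<longrightarrow> x $ 2 = 0) \<and> (4 < k \<longrightarrow> x $ 3 = 0) \<and> (8 < k \<longrightarrow> x $ 4 = 0)"
  using assms
proof induction
  case (mult k x l y)
  have half: "m < k \<or> m < l" if "2 * m < k + l" for m using that by linarith
  have z2: "x $ 1 = 0 \<or> y $ 1 = 0" if "2 < k + l"
    using half[of 1] that mult.IH by simp blast
  have z3: "x $ 1 = 0 \<and> x $ 2 = 0 \<or> y $ 1 = 0 \<and> y $ 2 = 0" if "4 < k + l"
  proof (cases "2 < k")
    case False
    then have "2 < l" using half[of 2] that by simp
    then show ?thesis using mult.IH(2) by simp
  qed (use mult.IH(1) in simp)
  have z4: "x $ 1 = 0 \<and> x $ 2 = 0 \<and> x $ 3 = 0 \<or> y $ 1 = 0 \<and> y $ 2 = 0 \<and> y $ 3 = 0" if "8 < k + l"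
  proof (cases "4 < k")
    case False
    then have "4 < l" using half[of 4] that by simp
    then show ?thesis using mult.IH(2) by simp
  qed (use mult.IH(1) in simp)
  show ?case
    unfolding alg_mult_tri
    by (intro conjI impI; (drule z2 | drule z3 | drule z4)?; auto)
qed simp

lemma multiply_out_gl_act:
  assumes "invertible g"
  shows "matrix_inv g *v multiply_out (gl_act g c) s = multiply_out c (map_bracketing ((*v) (matrix_inv g)) s)"
proof (induction s)
  case (Times s t)
  show ?case by (simp add: alg_mult_gl_act matrix_inv_mult(4)[OF assms] Times.IH)
qed simp

lemma factors_map: "factors (map_bracketing f s) = factors s"
  by (induction s) simp_all

lemma ninefold_products_vanish:
  assumes "invertible g"
    "c = gl_act g (tri a b\<^sub>1\<^sub>1 b\<^sub>1\<^sub>2 b\<^sub>2\<^sub>1 b\<^sub>2\<^sub>2 m\<^sub>1\<^sub>1 m\<^sub>1\<^sub>2 m\<^sub>1\<^sub>3 m\<^sub>2\<^sub>1 m\<^sub>2\<^sub>2 m\<^sub>2\<^sub>3 m\<^sub>3\<^sub>1 m\<^sub>3\<^sub>2 m\<^sub>3\<^sub>3)" (is "c = gl_act g ?d")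
    and "factors s = 9"
  shows "multiply_out c s = 0"
proof -
  let ?s = "map_bracketing ((*v) (matrix_inv g)) s"
  have "bracketed_product ?d 9 (multiply_out ?d ?s)"
    using assms(3) factors_map[of "(*v) (matrix_inv g)" s] unfolding bracketed_product_iff by metis
  then have "multiply_out ?d ?s = 0"
    using bracketed_product_tri by (fastforce simp: vec_eq_4)
  then have "matrix_inv g *v multiply_out c s = 0"
    using multiply_out_gl_act[OF assms(1)] assms(2) by metis
  then show ?thesis
    using matrix_inv_mult(3)[OF assms(1)] by (metis matrix_vector_mult_0_right)
qed

lemma nilpotent_alg_iff:
  fixes c :: "4 alg_structure"
  shows "nilpotent_alg c \<longleftrightarrow> (\<forall>s. factors s = 9 \<longrightarrow> multiply_out c s = 0)"
proof
  assume "nilpotent_alg c"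
  then show "\<forall>s. factors s = 9 \<longrightarrow> multiply_out c s = 0"
    using nilpotent_imp_triangular ninefold_products_vanish by metis
next
  assume "\<forall>s. factors s = 9 \<longrightarrow> multiply_out c s = 0"
  then show "nilpotent_alg c"
    unfolding nilpotent_alg_def bracketed_product_iff by (intro exI[of _ 9]) auto
qed

lemma nilpotent_gl_act_tri:
  assumes "invertible g"
  shows "nilpotent_alg (gl_act g (tri a b\<^sub>1\<^sub>1 b\<^sub>1\<^sub>2 b\<^sub>2\<^sub>1 b\<^sub>2\<^sub>2 m\<^sub>1\<^sub>1 m\<^sub>1\<^sub>2 m\<^sub>1\<^sub>3 m\<^sub>2\<^sub>1 m\<^sub>2\<^sub>2 m\<^sub>2\<^sub>3 m\<^sub>3\<^sub>1 m\<^sub>3\<^sub>2 m\<^sub>3\<^sub>3))"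
  unfolding nilpotent_alg_iff using ninefold_products_vanish[OF assms refl] by blast

lemma closedin_nilpotent_novikov: "closedin zariski (nilpotent_novikov :: 4 alg_structure set)"
proof -
  note poly = polynomial_fun_alg_mult polynomial_fun_multiply_out polynomial_fun_diff polynomial_fun.const
  define rc where "rc = (\<lambda>(x, y, z, k) (c :: 4 alg_structure).
    alg_mult c (alg_mult c x y) z $ k - alg_mult c (alg_mult c x z) y $ k)"
  define ls where "ls = (\<lambda>(x, y, z, k) (c :: 4 alg_structure).
    (alg_mult c (alg_mult c x y) z $ k - alg_mult c x (alg_mult c y z) $ k)
    - (alg_mult c (alg_mult c y x) z $ k - alg_mult c y (alg_mult c x z) $ k))"
  define ni where "ni = (\<lambda>(s, k) c. if factors s = 9 then multiply_out c s $ (k::4) else 0)"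
  have "polynomial_fun (rc i)" "polynomial_fun (ls i)" for i
    by (cases i; auto simp: rc_def ls_def intro!: poly)+
  moreover have "polynomial_fun (ni i)" for i
    by (cases i; cases "factors (fst i) = 9") (auto simp: ni_def intro!: poly)
  ultimately have *: "algebraic_set {c. \<forall>i. rc i c = 0}" "algebraic_set {c. \<forall>i. ls i c = 0}"
      "algebraic_set {c. \<forall>i. ni i c = 0}"
    by (simp_all only: algebraic_set_common_zeros)
  then have "algebraic_set (\<Inter>{{c. \<forall>i. rc i c = 0}, {c. \<forall>i. ls i c = 0}, {c. \<forall>i. ni i c = 0}})"
    by (intro algebraic_set_Inter) (elim insertE emptyE; simp only: *)
  moreover have "nilpotent_novikov = \<Inter>{{c. \<forall>i. rc i c = 0}, {c. \<forall>i. ls i c = 0}, {c. \<forall>i. ni i c = 0}}"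
  proof (rule set_eqI)
    fix c :: "4 alg_structure"
    have "novikov c \<longleftrightarrow> (\<forall>i. rc i c = 0) \<and> (\<forall>i. ls i c = 0)"
      unfolding novikov_def vec_eq_iff rc_def ls_def split_paired_All by simp blast
    moreover have "nilpotent_alg c \<longleftrightarrow> (\<forall>i. ni i c = 0)"
      unfolding nilpotent_alg_iff vec_eq_iff ni_def split_paired_All by auto
    ultimately show "c \<in> nilpotent_novikov \<longleftrightarrow>
        c \<in> \<Inter>{{c. \<forall>i. rc i c = 0}, {c. \<forall>i. ls i c = 0}, {c. \<forall>i. ni i c = 0}}"
      unfolding nilpotent_novikov_def by simp
  qed
  ultimately show ?thesis by (simp add: closedin_zariski)
qed

lemma novikov_gl_act_iff:
  assumes "invertible g"
  shows "novikov (gl_act g c) \<longleftrightarrow> novikov c"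
proof -
  have "novikov (gl_act g c)" if "novikov c" and g: "invertible g" for g c
    using that(1) unfolding novikov_def
    by (simp add: alg_mult_gl_act matrix_inv_mult g flip: matrix_vector_mult_diff_distrib)
  then show ?thesis using assms invertible_matrix_inv gl_act_inv by metis
qed

section \<open>The Novikov identities on triangular structures\<close>

text \<open>
  Each equation is one coordinate of an identity applied to three basis vectors.
\<close>

lemma novikov_tri:
  assumes "novikov (tri a b\<^sub>1\<^sub>1 b\<^sub>1\<^sub>2 b\<^sub>2\<^sub>1 b\<^sub>2\<^sub>2 m\<^sub>1\<^sub>1 m\<^sub>1\<^sub>2 m\<^sub>1\<^sub>3 m\<^sub>2\<^sub>1 m\<^sub>2\<^sub>2 m\<^sub>2\<^sub>3 m\<^sub>3\<^sub>1 m\<^sub>3\<^sub>2 m\<^sub>3\<^sub>3)"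
  shows "a * b\<^sub>2\<^sub>2 = 0" "a * m\<^sub>2\<^sub>2 + b\<^sub>1\<^sub>1 * m\<^sub>3\<^sub>2 = b\<^sub>1\<^sub>2 * m\<^sub>3\<^sub>1"
    "a * m\<^sub>2\<^sub>3 + b\<^sub>1\<^sub>1 * m\<^sub>3\<^sub>3 = 0" "a * m\<^sub>3\<^sub>2 + b\<^sub>1\<^sub>1 * m\<^sub>3\<^sub>3 = 0"
    "b\<^sub>1\<^sub>2 * m\<^sub>3\<^sub>3 = 0" "b\<^sub>2\<^sub>1 * m\<^sub>3\<^sub>3 = 0" "b\<^sub>2\<^sub>2 * m\<^sub>3\<^sub>3 = 0"
    "b\<^sub>2\<^sub>1 * m\<^sub>3\<^sub>2 = b\<^sub>2\<^sub>2 * m\<^sub>3\<^sub>1"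
    "(b\<^sub>1\<^sub>2 - b\<^sub>2\<^sub>1) * m\<^sub>3\<^sub>1 = b\<^sub>2\<^sub>1 * m\<^sub>1\<^sub>3 - a * m\<^sub>2\<^sub>2 - b\<^sub>1\<^sub>1 * m\<^sub>2\<^sub>3"
    "(b\<^sub>1\<^sub>2 - b\<^sub>2\<^sub>1) * m\<^sub>3\<^sub>2 = b\<^sub>2\<^sub>2 * m\<^sub>1\<^sub>3 - b\<^sub>1\<^sub>2 * m\<^sub>2\<^sub>3"
proof -
  note N = assms[unfolded novikov_def vec_eq_4, rule_format]
  show "a * b\<^sub>2\<^sub>2 = 0" "a * m\<^sub>2\<^sub>2 + b\<^sub>1\<^sub>1 * m\<^sub>3\<^sub>2 = b\<^sub>1\<^sub>2 * m\<^sub>3\<^sub>1"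
    using N[of "axis 1 1" "axis 1 1" "axis 2 1"] by (simp_all add: axis_def)
  show "a * m\<^sub>2\<^sub>3 + b\<^sub>1\<^sub>1 * m\<^sub>3\<^sub>3 = 0"
    using N[of "axis 1 1" "axis 1 1" "axis 3 1"] by (simp add: axis_def)
  show "a * m\<^sub>3\<^sub>2 + b\<^sub>1\<^sub>1 * m\<^sub>3\<^sub>3 = 0"
    using N[of "axis 1 1" "axis 3 1" "axis 1 1"] by (simp add: axis_def neg_eq_iff_add_eq_0)
  show "b\<^sub>1\<^sub>2 * m\<^sub>3\<^sub>3 = 0" "b\<^sub>2\<^sub>1 * m\<^sub>3\<^sub>3 = 0" "b\<^sub>2\<^sub>2 * m\<^sub>3\<^sub>3 = 0"
    using N[of "axis 1 1" "axis 2 1" "axis 3 1"] N[of "axis 2 1" "axis 1 1" "axis 3 1"]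
      N[of "axis 2 1" "axis 2 1" "axis 3 1"] by (simp_all add: axis_def)
  show "b\<^sub>2\<^sub>1 * m\<^sub>3\<^sub>2 = b\<^sub>2\<^sub>2 * m\<^sub>3\<^sub>1"
    using N[of "axis 2 1" "axis 1 1" "axis 2 1"] by (simp add: axis_def)
  show "(b\<^sub>1\<^sub>2 - b\<^sub>2\<^sub>1) * m\<^sub>3\<^sub>1 = b\<^sub>2\<^sub>1 * m\<^sub>1\<^sub>3 - a * m\<^sub>2\<^sub>2 - b\<^sub>1\<^sub>1 * m\<^sub>2\<^sub>3"
    using N[of "axis 1 1" "axis 2 1" "axis 1 1"] by (simp add: axis_def algebra_simps) (elim conjE, algebra)
  show "(b\<^sub>1\<^sub>2 - b\<^sub>2\<^sub>1) * m\<^sub>3\<^sub>2 = b\<^sub>2\<^sub>2 * m\<^sub>1\<^sub>3 - b\<^sub>1\<^sub>2 * m\<^sub>2\<^sub>3"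
    using N[of "axis 1 1" "axis 2 1" "axis 2 1"] by (simp add: axis_def algebra_simps)
qed

lemma novikov_N20: "novikov (N20 \<alpha>)"
  unfolding novikov_def vec_eq_4 N20_eq_tri by (simp add: algebra_simps)

lemma novikov_N22: "novikov (N22 l)"
  unfolding novikov_def vec_eq_4 N22_eq_tri by (simp add: algebra_simps)

text \<open>
  To exhibit \<open>c\<close> as conjugate to a triangular structure it suffices to have a basis with the
  multiplication table of the latter.
\<close>

lemma gl_act_tri_eqI:
  assumes "invertible (from_cols u\<^sub>1 u\<^sub>2 u\<^sub>3 u\<^sub>4)"
    and "alg_mult c u\<^sub>1 u\<^sub>1 = a *s u\<^sub>2 + b\<^sub>1\<^sub>1 *s u\<^sub>3 + m\<^sub>1\<^sub>1 *s u\<^sub>4"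
    and "alg_mult c u\<^sub>1 u\<^sub>2 = b\<^sub>1\<^sub>2 *s u\<^sub>3 + m\<^sub>1\<^sub>2 *s u\<^sub>4" "alg_mult c u\<^sub>1 u\<^sub>3 = m\<^sub>1\<^sub>3 *s u\<^sub>4"
    and "alg_mult c u\<^sub>2 u\<^sub>1 = b\<^sub>2\<^sub>1 *s u\<^sub>3 + m\<^sub>2\<^sub>1 *s u\<^sub>4" "alg_mult c u\<^sub>2 u\<^sub>2 = b\<^sub>2\<^sub>2 *s u\<^sub>3 + m\<^sub>2\<^sub>2 *s u\<^sub>4"
    and "alg_mult c u\<^sub>2 u\<^sub>3 = m\<^sub>2\<^sub>3 *s u\<^sub>4" "alg_mult c u\<^sub>3 u\<^sub>1 = m\<^sub>3\<^sub>1 *s u\<^sub>4"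
    and "alg_mult c u\<^sub>3 u\<^sub>2 = m\<^sub>3\<^sub>2 *s u\<^sub>4" "alg_mult c u\<^sub>3 u\<^sub>3 = m\<^sub>3\<^sub>3 *s u\<^sub>4"
    and "\<And>x. alg_mult c x u\<^sub>4 = 0" "\<And>x. alg_mult c u\<^sub>4 x = 0"
  shows "gl_act (from_cols u\<^sub>1 u\<^sub>2 u\<^sub>3 u\<^sub>4)
      (tri a b\<^sub>1\<^sub>1 b\<^sub>1\<^sub>2 b\<^sub>2\<^sub>1 b\<^sub>2\<^sub>2 m\<^sub>1\<^sub>1 m\<^sub>1\<^sub>2 m\<^sub>1\<^sub>3 m\<^sub>2\<^sub>1 m\<^sub>2\<^sub>2 m\<^sub>2\<^sub>3 m\<^sub>3\<^sub>1 m\<^sub>3\<^sub>2 m\<^sub>3\<^sub>3) = c"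
  by (rule gl_act_eqI[OF assms(1)])
    (simp add: from_cols_mult alg_mult_add alg_mult_scale assms(2-), simp add: vec_eq_iff algebra_simps)

definition vec4 :: "complex \<Rightarrow> complex \<Rightarrow> complex \<Rightarrow> complex \<Rightarrow> complex ^ 4" where
  "vec4 p q r s = (\<chi> i. if i = 1 then p else if i = 2 then q else if i = 3 then r else s)"

lemma vec4_nth [simp]: "vec4 p q r s $ 1 = p" "vec4 p q r s $ 2 = q" "vec4 p q r s $ 3 = r" "vec4 p q r s $ 4 = s"
  by (simp_all add: vec4_def)

lemma invertible_from_cols_block:
  assumes "p\<^sub>1 * q\<^sub>2 - p\<^sub>2 * q\<^sub>1 \<noteq> 0" "r \<noteq> 0" "s \<noteq> 0"
  shows "invertible (from_cols (vec4 p\<^sub>1 q\<^sub>1 v\<^sub>1 w\<^sub>1) (vec4 p\<^sub>2 q\<^sub>2 v\<^sub>2 w\<^sub>2) (vec4 0 0 r w\<^sub>3) (vec4 0 0 0 s))"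
proof (rule invertible_if_ker)
  fix x assume *: "from_cols (vec4 p\<^sub>1 q\<^sub>1 v\<^sub>1 w\<^sub>1) (vec4 p\<^sub>2 q\<^sub>2 v\<^sub>2 w\<^sub>2) (vec4 0 0 r w\<^sub>3) (vec4 0 0 0 s) *v x = 0"
  then have e: "x $ 1 * p\<^sub>1 + x $ 2 * p\<^sub>2 = 0" "x $ 1 * q\<^sub>1 + x $ 2 * q\<^sub>2 = 0"
    by (simp_all add: from_cols_mult vec_eq_4)
  have "x $ 1 * (p\<^sub>1 * q\<^sub>2 - p\<^sub>2 * q\<^sub>1) = 0" "x $ 2 * (p\<^sub>1 * q\<^sub>2 - p\<^sub>2 * q\<^sub>1) = 0"
    using e by algebra+
  then have "x $ 1 = 0" "x $ 2 = 0" using assms(1) by auto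
  with * assms show "x $ 1 = 0 \<and> x $ 2 = 0 \<and> x $ 3 = 0 \<and> x $ 4 = 0"
    by (auto simp: from_cols_mult vec_eq_4)
qed

text \<open>
  A bilinear form on a plane with vanishing determinant is a product of two linear forms.
\<close>

lemma rank_one_2x2:
  fixes b c d f :: complex
  assumes "b * f = c * d"
  shows "\<exists>s\<^sub>1 s\<^sub>2 r\<^sub>1 r\<^sub>2. b = s\<^sub>1 * r\<^sub>1 \<and> c = s\<^sub>1 * r\<^sub>2 \<and> d = s\<^sub>2 * r\<^sub>1 \<and> f = s\<^sub>2 * r\<^sub>2"
proof (cases "b = 0 \<and> c = 0")
  case True
  then show ?thesis by (intro exI[of _ 0] exI[of _ 1] exI[of _ d] exI[of _ f]) simp
next
  case False
  then obtain k where "d = k * b" "f = k * c"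
  proof (cases "b = 0")
    case True
    with False assms have "d = 0" by simp
    with True False show thesis by (intro that[of "f / c"]) simp_all
  next
    case nz: False
    with assms show thesis by (intro that[of "d / b"]) (simp_all add: field_simps)
  qed
  then show ?thesis by (intro exI[of _ 1] exI[of _ k] exI[of _ b] exI[of _ c]) simp
qed

section \<open>The closure of the first family\<close>

abbreviation (input) closure_N20 :: "4 alg_structure set" where
  "closure_N20 \<equiv> zariski closure_of (\<Union>\<alpha>. gl_orbit (N20 \<alpha>))"

abbreviation (input) closure_N22 :: "4 alg_structure set" where
  "closure_N22 \<equiv> zariski closure_of (\<Union>l. gl_orbit (N22 l))"

lemma N20_in_closure: "N20 \<alpha> \<in> closure_N20"
  using closure_of_subset[of "\<Union>\<alpha>. gl_orbit (N20 \<alpha>)" zariski] in_gl_orbit by auto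

lemma N22_in_closure: "N22 l \<in> closure_N22"
  using closure_of_subset[of "\<Union>l. gl_orbit (N22 l)" zariski] in_gl_orbit by auto

text \<open>
  With \<open>B = s \<otimes> r\<close>, \<open>l = t s - r\<close> and \<open>M\<close> the form with matrix \<open>m\<^sub>i\<^sub>j\<close> on the plane \<open>e\<^sub>1, e\<^sub>2\<close>: in
  \<open>N20\<close> the vectors \<open>e\<^sub>1\<close> and \<open>e\<^sub>2\<close> are annihilated by \<open>r\<close> and \<open>s\<close> respectively, which determines
  the first two vectors of the new basis up to scalars and multiples of \<open>e\<^sub>3, e\<^sub>4\<close>. The hypotheses
  say that \<open>s\<close> and \<open>r\<close> are independent, \<open>t \<noteq> 0\<close>, and the quadratic form of \<open>M\<close> does not vanish on
  the kernel of \<open>s\<close>.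
\<close>

lemma generic_in_closure_N20:
  assumes "s\<^sub>1 * r\<^sub>2 - s\<^sub>2 * r\<^sub>1 \<noteq> 0" and t: "t \<noteq> 0"
    and "m\<^sub>1\<^sub>1 * s\<^sub>2 ^ 2 - (m\<^sub>1\<^sub>2 + m\<^sub>2\<^sub>1) * s\<^sub>1 * s\<^sub>2 + m\<^sub>2\<^sub>2 * s\<^sub>1 ^ 2 \<noteq> 0"
  shows "tri 0 (s\<^sub>1 * r\<^sub>1) (s\<^sub>1 * r\<^sub>2) (s\<^sub>2 * r\<^sub>1) (s\<^sub>2 * r\<^sub>2) m\<^sub>1\<^sub>1 m\<^sub>1\<^sub>2 (t * s\<^sub>1 - r\<^sub>1) m\<^sub>2\<^sub>1 m\<^sub>2\<^sub>2 (t * s\<^sub>2 - r\<^sub>2) r\<^sub>1 r\<^sub>2 0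
    \<in> closure_N20" (is "?c \<in> _")
proof -
  define \<delta> where "\<delta> = s\<^sub>1 * r\<^sub>2 - s\<^sub>2 * r\<^sub>1"
  define \<mu> where "\<mu> = m\<^sub>1\<^sub>1 * s\<^sub>2 ^ 2 - (m\<^sub>1\<^sub>2 + m\<^sub>2\<^sub>1) * s\<^sub>1 * s\<^sub>2 + m\<^sub>2\<^sub>2 * s\<^sub>1 ^ 2"
  \<comment> \<open>The scales \<open>p\<close> of \<open>u\<^sub>1\<close> and \<open>t p\<close> of \<open>u\<^sub>2\<close> are fixed by \<open>u\<^sub>1 u\<^sub>3 = u\<^sub>2 u\<^sub>3\<close> and \<open>u\<^sub>2 u\<^sub>2 = u\<^sub>2 u\<^sub>3\<close>, and the coefficient \<open>u\<close> of \<open>e\<^sub>3\<close> in \<open>u\<^sub>1\<close> by \<open>u\<^sub>2 u\<^sub>1 = 0\<close>.\<close>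
  define p where "p = - \<mu> / \<delta> ^ 3"
  define u where "u = - p * (s\<^sub>2 * r\<^sub>2 * m\<^sub>1\<^sub>1 - s\<^sub>2 * r\<^sub>1 * m\<^sub>1\<^sub>2 - s\<^sub>1 * r\<^sub>2 * m\<^sub>2\<^sub>1 + s\<^sub>1 * r\<^sub>1 * m\<^sub>2\<^sub>2) / \<delta>"
  have "\<mu> \<noteq> 0" unfolding \<mu>_def by (rule assms(3))
  then have nz: "\<delta> \<noteq> 0" "p \<noteq> 0" using assms(1) by (simp_all add: \<delta>_def p_def)
  have p: "p * \<delta> ^ 3 = - \<mu>" and u: "u * \<delta> = - p * (s\<^sub>2 * r\<^sub>2 * m\<^sub>1\<^sub>1 - s\<^sub>2 * r\<^sub>1 * m\<^sub>1\<^sub>2 - s\<^sub>1 * r\<^sub>2 * m\<^sub>2\<^sub>1 + s\<^sub>1 * r\<^sub>1 * m\<^sub>2\<^sub>2)"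
    using nz by (simp_all add: p_def u_def)
  \<comment> \<open>\<open>u\<^sub>3\<close> is the product \<open>u\<^sub>1 u\<^sub>2\<close> and \<open>u\<^sub>4\<close> is \<open>u\<^sub>1 u\<^sub>3\<close>; the parameter of the family is read off from \<open>u\<^sub>1 u\<^sub>1\<close>.\<close>
  define e where "e = - (t ^ 2 * p ^ 3 * \<delta> ^ 3)"
  define h where "h = t * p ^ 2 * (s\<^sub>2 * r\<^sub>2 * m\<^sub>1\<^sub>1 - r\<^sub>2 * s\<^sub>1 * m\<^sub>1\<^sub>2 - r\<^sub>1 * s\<^sub>2 * m\<^sub>2\<^sub>1 + s\<^sub>1 * r\<^sub>1 * m\<^sub>2\<^sub>2) - u * t * p * \<delta>"
  define \<alpha> where "\<alpha> = (p ^ 2 * (r\<^sub>2 ^ 2 * m\<^sub>1\<^sub>1 - r\<^sub>1 * r\<^sub>2 * (m\<^sub>1\<^sub>2 + m\<^sub>2\<^sub>1) + r\<^sub>1 ^ 2 * m\<^sub>2\<^sub>2) + u * t * p * \<delta>) / e"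
  have e: "e \<noteq> 0" using nz t by (simp add: e_def)
  have \<alpha>: "\<alpha> * e = p ^ 2 * (r\<^sub>2 ^ 2 * m\<^sub>1\<^sub>1 - r\<^sub>1 * r\<^sub>2 * (m\<^sub>1\<^sub>2 + m\<^sub>2\<^sub>1) + r\<^sub>1 ^ 2 * m\<^sub>2\<^sub>2) + u * t * p * \<delta>"
    using e by (simp add: \<alpha>_def)
  have e2: "e = t ^ 2 * p ^ 2 * \<mu>" using p unfolding e_def by algebra
  let ?u1 = "vec4 (p * r\<^sub>2) (- p * r\<^sub>1) u 0"
  let ?u2 = "vec4 (t * p * s\<^sub>2) (- t * p * s\<^sub>1) 0 0"
  let ?u3 = "vec4 0 0 (- t * p ^ 2 * \<delta> ^ 2) h"
  let ?u4 = "vec4 0 0 0 e"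
  have "p * r\<^sub>2 * (- t * p * s\<^sub>1) - t * p * s\<^sub>2 * (- p * r\<^sub>1) = - t * p ^ 2 * \<delta>"
    unfolding \<delta>_def by algebra
  then have inv: "invertible (from_cols ?u1 ?u2 ?u3 ?u4)"
    using nz t e by (intro invertible_from_cols_block) simp_all
  have "gl_act (from_cols ?u1 ?u2 ?u3 ?u4) (N20 \<alpha>) = ?c"
    unfolding N20_eq_tri
  proof (rule gl_act_tri_eqI[OF inv])
    show "alg_mult ?c ?u1 ?u1 = 0 *s ?u2 + 0 *s ?u3 + \<alpha> *s ?u4"
      by (simp add: vec_eq_4 \<alpha>) (simp add: \<delta>_def algebra_simps power2_eq_square)
    show "alg_mult ?c ?u1 ?u2 = 1 *s ?u3 + 0 *s ?u4"
      by (simp add: vec_eq_4 h_def) (simp add: \<delta>_def algebra_simps power2_eq_square)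
    show "alg_mult ?c ?u1 ?u3 = 1 *s ?u4"
      by (simp add: vec_eq_4 e_def) (simp add: \<delta>_def algebra_simps power2_eq_square power3_eq_cube)
    show "alg_mult ?c ?u2 ?u1 = 0 *s ?u3 + 0 *s ?u4"
      using u unfolding \<delta>_def by (simp add: vec_eq_4) algebra
    show "alg_mult ?c ?u2 ?u2 = 0 *s ?u3 + 1 *s ?u4"
      by (simp add: vec_eq_4 e2) (simp add: \<mu>_def algebra_simps power2_eq_square)
    show "alg_mult ?c ?u2 ?u3 = 1 *s ?u4"
      by (simp add: vec_eq_4 e_def) (simp add: \<delta>_def algebra_simps power2_eq_square power3_eq_cube)
    show "alg_mult ?c ?u3 ?u1 = 0 *s ?u4"
      by (simp add: vec_eq_4)
    show "alg_mult ?c ?u3 ?u2 = - 1 *s ?u4"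
      by (simp add: vec_eq_4 e_def) (simp add: \<delta>_def algebra_simps power2_eq_square power3_eq_cube)
  qed (simp_all add: vec_eq_4)
  then show ?thesis using gl_act_in_orbit_closure[OF N20_in_closure inv] by metis
qed

lemma finite_zeros_if_poly:
  assumes "\<And>t. f t = poly q t" "q \<noteq> 0"
  shows "finite {t. f t = (0::complex)}"
  using poly_roots_finite[OF assms(2)] assms(1) by simp

text \<open>
  The genericity conditions can be restored by moving \<open>s\<^sub>1\<close>, \<open>r\<^sub>2\<close>, \<open>t\<close> and \<open>m\<^sub>2\<^sub>2\<close>: along this line
  the three expressions that must not vanish are monic polynomials in the parameter.
\<close>

lemma parametrised_in_closure_N20:
  "tri 0 (s\<^sub>1 * r\<^sub>1) (s\<^sub>1 * r\<^sub>2) (s\<^sub>2 * r\<^sub>1) (s\<^sub>2 * r\<^sub>2) m\<^sub>1\<^sub>1 m\<^sub>1\<^sub>2 (t * s\<^sub>1 - r\<^sub>1) m\<^sub>2\<^sub>1 m\<^sub>2\<^sub>2 (t * s\<^sub>2 - r\<^sub>2) r\<^sub>1 r\<^sub>2 0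
    \<in> closure_N20"
proof -
  let ?\<delta> = "\<lambda>\<tau>. (s\<^sub>1 + \<tau>) * (r\<^sub>2 + \<tau>) - s\<^sub>2 * r\<^sub>1"
  let ?\<mu> = "\<lambda>\<tau>. m\<^sub>1\<^sub>1 * s\<^sub>2 ^ 2 - (m\<^sub>1\<^sub>2 + m\<^sub>2\<^sub>1) * (s\<^sub>1 + \<tau>) * s\<^sub>2 + (m\<^sub>2\<^sub>2 + \<tau>) * (s\<^sub>1 + \<tau>) ^ 2"
  let ?c = "\<lambda>\<tau>. tri 0 ((s\<^sub>1 + \<tau>) * r\<^sub>1) ((s\<^sub>1 + \<tau>) * (r\<^sub>2 + \<tau>)) (s\<^sub>2 * r\<^sub>1) (s\<^sub>2 * (r\<^sub>2 + \<tau>))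
    m\<^sub>1\<^sub>1 m\<^sub>1\<^sub>2 ((t + \<tau>) * (s\<^sub>1 + \<tau>) - r\<^sub>1) m\<^sub>2\<^sub>1 (m\<^sub>2\<^sub>2 + \<tau>) ((t + \<tau>) * s\<^sub>2 - (r\<^sub>2 + \<tau>)) r\<^sub>1 (r\<^sub>2 + \<tau>) 0"
  have "finite {\<tau>. ?\<delta> \<tau> = 0}"
    by (rule finite_zeros_if_poly[of _ "[:s\<^sub>1 * r\<^sub>2 - s\<^sub>2 * r\<^sub>1, s\<^sub>1 + r\<^sub>2, 1:]"]) (simp_all add: algebra_simps)
  moreover have "finite {\<tau>. ?\<mu> \<tau> = 0}"
    by (rule finite_zeros_if_poly[of _ "[:m\<^sub>1\<^sub>1 * s\<^sub>2 ^ 2 - (m\<^sub>1\<^sub>2 + m\<^sub>2\<^sub>1) * s\<^sub>1 * s\<^sub>2 + m\<^sub>2\<^sub>2 * s\<^sub>1 ^ 2,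
      2 * s\<^sub>1 * m\<^sub>2\<^sub>2 + s\<^sub>1 ^ 2 - (m\<^sub>1\<^sub>2 + m\<^sub>2\<^sub>1) * s\<^sub>2, m\<^sub>2\<^sub>2 + 2 * s\<^sub>1, 1:]"])
      (simp_all add: algebra_simps power2_eq_square)
  ultimately have fin: "finite ({\<tau>. ?\<delta> \<tau> = 0} \<union> {\<tau>. ?\<mu> \<tau> = 0} \<union> {- t})" by blast
  have lim: "(?c \<longlongrightarrow> ?c 0) (at 0)" by (intro tendsto_intros)
  have "?c 0 \<in> closure_N20"
  proof (rule in_zariski_closure_by_limit[OF lim fin])
    fix \<tau> assume "\<tau> \<notin> {\<tau>. ?\<delta> \<tau> = 0} \<union> {\<tau>. ?\<mu> \<tau> = 0} \<union> {- t}"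
    moreover from this have "t + \<tau> \<noteq> 0" by (auto simp: add_eq_0_iff)
    ultimately show "?c \<tau> \<in> closure_N20" by (intro generic_in_closure_N20) blast+
  qed
  then show ?thesis by simp
qed

text \<open>
  The case \<open>B = 0\<close>, where \<open>r\<close> and \<open>l\<close> are arbitrary: take \<open>s = \<tau> (r + l)\<close> and \<open>t = 1 / \<tau>\<close>.
\<close>

lemma square_in_line_in_closure_N20:
  "tri 0 0 0 0 0 m\<^sub>1\<^sub>1 m\<^sub>1\<^sub>2 m\<^sub>1\<^sub>3 m\<^sub>2\<^sub>1 m\<^sub>2\<^sub>2 m\<^sub>2\<^sub>3 m\<^sub>3\<^sub>1 m\<^sub>3\<^sub>2 0 \<in> closure_N20"
proof -
  let ?c = "\<lambda>\<tau>. tri 0 (\<tau> * (m\<^sub>1\<^sub>3 + m\<^sub>3\<^sub>1) * m\<^sub>3\<^sub>1) (\<tau> * (m\<^sub>1\<^sub>3 + m\<^sub>3\<^sub>1) * m\<^sub>3\<^sub>2) (\<tau> * (m\<^sub>2\<^sub>3 + m\<^sub>3\<^sub>2) * m\<^sub>3\<^sub>1)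
    (\<tau> * (m\<^sub>2\<^sub>3 + m\<^sub>3\<^sub>2) * m\<^sub>3\<^sub>2) m\<^sub>1\<^sub>1 m\<^sub>1\<^sub>2 m\<^sub>1\<^sub>3 m\<^sub>2\<^sub>1 m\<^sub>2\<^sub>2 m\<^sub>2\<^sub>3 m\<^sub>3\<^sub>1 m\<^sub>3\<^sub>2 0"
  have lim: "(?c \<longlongrightarrow> ?c 0) (at 0)" by (intro tendsto_intros)
  have "?c 0 \<in> closure_N20"
  proof (rule in_zariski_closure_by_limit[OF lim finite.emptyI])
    fix \<tau> :: complex assume "\<tau> \<noteq> 0"
    then show "?c \<tau> \<in> closure_N20"
      using parametrised_in_closure_N20[of "\<tau> * (m\<^sub>1\<^sub>3 + m\<^sub>3\<^sub>1)" m\<^sub>3\<^sub>1 m\<^sub>3\<^sub>2 "\<tau> * (m\<^sub>2\<^sub>3 + m\<^sub>3\<^sub>2)" m\<^sub>1\<^sub>1 m\<^sub>1\<^sub>2 "1 / \<tau>"]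
      by simp
  qed
  then show ?thesis by simp
qed

text \<open>
  The case \<open>r = 0\<close>, \<open>B = l \<otimes> w\<close>: take \<open>r = \<tau> w\<close>, \<open>s = (l + \<tau> w) / \<tau>\<close> and \<open>t = \<tau>\<close>.
\<close>

lemma left_annihilated_in_closure_N20:
  "tri 0 (l\<^sub>1 * w\<^sub>1) (l\<^sub>1 * w\<^sub>2) (l\<^sub>2 * w\<^sub>1) (l\<^sub>2 * w\<^sub>2) m\<^sub>1\<^sub>1 m\<^sub>1\<^sub>2 l\<^sub>1 m\<^sub>2\<^sub>1 m\<^sub>2\<^sub>2 l\<^sub>2 0 0 0 \<in> closure_N20"
proof -
  let ?c = "\<lambda>\<tau>. tri 0 ((l\<^sub>1 + \<tau> * w\<^sub>1) * w\<^sub>1) ((l\<^sub>1 + \<tau> * w\<^sub>1) * w\<^sub>2) ((l\<^sub>2 + \<tau> * w\<^sub>2) * w\<^sub>1)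
    ((l\<^sub>2 + \<tau> * w\<^sub>2) * w\<^sub>2) m\<^sub>1\<^sub>1 m\<^sub>1\<^sub>2 l\<^sub>1 m\<^sub>2\<^sub>1 m\<^sub>2\<^sub>2 l\<^sub>2 (\<tau> * w\<^sub>1) (\<tau> * w\<^sub>2) 0"
  have lim: "(?c \<longlongrightarrow> ?c 0) (at 0)" by (intro tendsto_intros)
  have "?c 0 \<in> closure_N20"
  proof (rule in_zariski_closure_by_limit[OF lim finite.emptyI])
    fix \<tau> :: complex assume "\<tau> \<noteq> 0"
    then show "?c \<tau> \<in> closure_N20"
      using parametrised_in_closure_N20[of "(l\<^sub>1 + \<tau> * w\<^sub>1) / \<tau>" "\<tau> * w\<^sub>1" "\<tau> * w\<^sub>2" "(l\<^sub>2 + \<tau> * w\<^sub>2) / \<tau>" m\<^sub>1\<^sub>1 m\<^sub>1\<^sub>2 \<tau>]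
      by simp
  qed
  then show ?thesis by simp
qed

text \<open>
  If \<open>B = s \<otimes> r'\<close> and \<open>e\<^sub>3\<close> annihilates the algebra, let \<open>r = \<tau> r'\<close> tend to 0, with \<open>s / \<tau>\<close> in
  place of \<open>s\<close> and \<open>t = 0\<close>.
\<close>

lemma degenerate_pencil_in_closure_N20:
  assumes "b\<^sub>1\<^sub>1 * b\<^sub>2\<^sub>2 = b\<^sub>1\<^sub>2 * b\<^sub>2\<^sub>1"
  shows "tri 0 b\<^sub>1\<^sub>1 b\<^sub>1\<^sub>2 b\<^sub>2\<^sub>1 b\<^sub>2\<^sub>2 m\<^sub>1\<^sub>1 m\<^sub>1\<^sub>2 0 m\<^sub>2\<^sub>1 m\<^sub>2\<^sub>2 0 0 0 0 \<in> closure_N20"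
proof -
  obtain s\<^sub>1 s\<^sub>2 r\<^sub>1 r\<^sub>2 where b: "b\<^sub>1\<^sub>1 = s\<^sub>1 * r\<^sub>1" "b\<^sub>1\<^sub>2 = s\<^sub>1 * r\<^sub>2" "b\<^sub>2\<^sub>1 = s\<^sub>2 * r\<^sub>1" "b\<^sub>2\<^sub>2 = s\<^sub>2 * r\<^sub>2"
    using rank_one_2x2[OF assms] by blast
  let ?c = "\<lambda>\<tau>. tri 0 (s\<^sub>1 * r\<^sub>1) (s\<^sub>1 * r\<^sub>2) (s\<^sub>2 * r\<^sub>1) (s\<^sub>2 * r\<^sub>2) m\<^sub>1\<^sub>1 m\<^sub>1\<^sub>2 (- \<tau> * r\<^sub>1) m\<^sub>2\<^sub>1 m\<^sub>2\<^sub>2 (- \<tau> * r\<^sub>2)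
    (\<tau> * r\<^sub>1) (\<tau> * r\<^sub>2) 0"
  have lim: "(?c \<longlongrightarrow> ?c 0) (at 0)" by (intro tendsto_intros)
  have "?c 0 \<in> closure_N20"
  proof (rule in_zariski_closure_by_limit[OF lim finite.emptyI])
    fix \<tau> :: complex assume "\<tau> \<noteq> 0"
    then show "?c \<tau> \<in> closure_N20"
      using parametrised_in_closure_N20[of "s\<^sub>1 / \<tau>" "\<tau> * r\<^sub>1" "\<tau> * r\<^sub>2" "s\<^sub>2 / \<tau>" m\<^sub>1\<^sub>1 m\<^sub>1\<^sub>2 0]
      by simp
  qed
  then show ?thesis by (simp add: b)
qed

lemma exists_quadratic_root:
  fixes p q r :: complex
  assumes "p \<noteq> 0"
  shows "\<exists>z. p * z ^ 2 + q * z + r = 0"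
proof
  let ?d = "csqrt (q ^ 2 - 4 * p * r)"
  have "4 * p * (p * ((?d - q) / (2 * p)) ^ 2 + q * ((?d - q) / (2 * p)) + r) = ?d ^ 2 - q ^ 2 + 4 * p * r"
    using assms by (simp add: field_simps power2_eq_square)
  then have "4 * p * (p * ((?d - q) / (2 * p)) ^ 2 + q * ((?d - q) / (2 * p)) + r) = 0"
    by (simp del: csqrt.simps)
  then show "p * ((?d - q) / (2 * p)) ^ 2 + q * ((?d - q) / (2 * p)) + r = 0"
    using assms by simp
qed

text \<open>
  If both \<open>e\<^sub>3\<close> and \<open>e\<^sub>4\<close> annihilate the algebra, the product is a pencil of bilinear forms on a
  plane. A pencil over the complex numbers has a degenerate member, which becomes the
  \<open>e\<^sub>3\<close>-component after a change of basis in the plane \<open>e\<^sub>3, e\<^sub>4\<close>.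
\<close>

lemma pencil_in_closure_N20:
  "tri 0 b\<^sub>1\<^sub>1 b\<^sub>1\<^sub>2 b\<^sub>2\<^sub>1 b\<^sub>2\<^sub>2 m\<^sub>1\<^sub>1 m\<^sub>1\<^sub>2 0 m\<^sub>2\<^sub>1 m\<^sub>2\<^sub>2 0 0 0 0 \<in> closure_N20" (is "?c \<in> _")
proof (cases "m\<^sub>1\<^sub>1 * m\<^sub>2\<^sub>2 = m\<^sub>1\<^sub>2 * m\<^sub>2\<^sub>1")
  case True
  let ?g = "from_cols (vec4 1 0 0 0) (vec4 0 1 0 0) (vec4 0 0 0 1) (vec4 0 0 1 0)"
  have inv: "invertible ?g"
    by (rule invertible_if_ker) (simp add: from_cols_mult vec_eq_4)
  have "gl_act ?g (tri 0 m\<^sub>1\<^sub>1 m\<^sub>1\<^sub>2 m\<^sub>2\<^sub>1 m\<^sub>2\<^sub>2 b\<^sub>1\<^sub>1 b\<^sub>1\<^sub>2 0 b\<^sub>2\<^sub>1 b\<^sub>2\<^sub>2 0 0 0 0) = ?c"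
    by (rule gl_act_tri_eqI[OF inv]) (simp_all add: vec_eq_4)
  then show ?thesis
    using gl_act_in_orbit_closure[OF degenerate_pencil_in_closure_N20[OF True] inv] by metis
next
  case False
  then have "m\<^sub>1\<^sub>1 * m\<^sub>2\<^sub>2 - m\<^sub>1\<^sub>2 * m\<^sub>2\<^sub>1 \<noteq> 0" by simp
  from exists_quadratic_root[OF this] obtain k where
    "(m\<^sub>1\<^sub>1 * m\<^sub>2\<^sub>2 - m\<^sub>1\<^sub>2 * m\<^sub>2\<^sub>1) * k ^ 2 +
      (b\<^sub>1\<^sub>2 * m\<^sub>2\<^sub>1 + b\<^sub>2\<^sub>1 * m\<^sub>1\<^sub>2 - b\<^sub>1\<^sub>1 * m\<^sub>2\<^sub>2 - b\<^sub>2\<^sub>2 * m\<^sub>1\<^sub>1) * k + (b\<^sub>1\<^sub>1 * b\<^sub>2\<^sub>2 - b\<^sub>1\<^sub>2 * b\<^sub>2\<^sub>1) = 0" by blast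
  then have k: "(b\<^sub>1\<^sub>1 - k * m\<^sub>1\<^sub>1) * (b\<^sub>2\<^sub>2 - k * m\<^sub>2\<^sub>2) = (b\<^sub>1\<^sub>2 - k * m\<^sub>1\<^sub>2) * (b\<^sub>2\<^sub>1 - k * m\<^sub>2\<^sub>1)"
    by algebra
  let ?g = "from_cols (vec4 1 0 0 0) (vec4 0 1 0 0) (vec4 0 0 1 0) (vec4 0 0 k 1)"
  have inv: "invertible ?g"
    by (rule invertible_if_ker) (auto simp: from_cols_mult vec_eq_4)
  have "gl_act ?g (tri 0 (b\<^sub>1\<^sub>1 - k * m\<^sub>1\<^sub>1) (b\<^sub>1\<^sub>2 - k * m\<^sub>1\<^sub>2) (b\<^sub>2\<^sub>1 - k * m\<^sub>2\<^sub>1) (b\<^sub>2\<^sub>2 - k * m\<^sub>2\<^sub>2)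
      m\<^sub>1\<^sub>1 m\<^sub>1\<^sub>2 0 m\<^sub>2\<^sub>1 m\<^sub>2\<^sub>2 0 0 0 0) = ?c"
    by (rule gl_act_tri_eqI[OF inv]) (simp_all add: vec_eq_4)
  then show ?thesis
    using gl_act_in_orbit_closure[OF degenerate_pencil_in_closure_N20[OF k] inv] by metis
qed

lemma proportional_pair:
  fixes x\<^sub>1 x\<^sub>2 y\<^sub>1 y\<^sub>2 :: complex
  assumes "x\<^sub>1 * y\<^sub>2 = x\<^sub>2 * y\<^sub>1" "x\<^sub>1 \<noteq> 0 \<or> x\<^sub>2 \<noteq> 0"
  shows "\<exists>k. y\<^sub>1 = k * x\<^sub>1 \<and> y\<^sub>2 = k * x\<^sub>2"
proof (cases "x\<^sub>1 = 0")
  case True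
  with assms show ?thesis by (intro exI[of _ "y\<^sub>2 / x\<^sub>2"]) auto
next
  case False
  with assms show ?thesis by (intro exI[of _ "y\<^sub>1 / x\<^sub>1"]) (simp add: field_simps)
qed

text \<open>
  If \<open>r \<noteq> 0\<close>, the equations say that the rows of \<open>B\<close> are multiples of \<open>r\<close> and that \<open>s\<close> and \<open>r + l\<close>
  are proportional; if \<open>r = 0\<close>, that the columns of \<open>B\<close> are proportional to \<open>l\<close>.
\<close>

lemma novikov_tri_in_closure_N20:
  assumes "novikov (tri 0 b\<^sub>1\<^sub>1 b\<^sub>1\<^sub>2 b\<^sub>2\<^sub>1 b\<^sub>2\<^sub>2 m\<^sub>1\<^sub>1 m\<^sub>1\<^sub>2 m\<^sub>1\<^sub>3 m\<^sub>2\<^sub>1 m\<^sub>2\<^sub>2 m\<^sub>2\<^sub>3 m\<^sub>3\<^sub>1 m\<^sub>3\<^sub>2 0)"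
  shows "tri 0 b\<^sub>1\<^sub>1 b\<^sub>1\<^sub>2 b\<^sub>2\<^sub>1 b\<^sub>2\<^sub>2 m\<^sub>1\<^sub>1 m\<^sub>1\<^sub>2 m\<^sub>1\<^sub>3 m\<^sub>2\<^sub>1 m\<^sub>2\<^sub>2 m\<^sub>2\<^sub>3 m\<^sub>3\<^sub>1 m\<^sub>3\<^sub>2 0 \<in> closure_N20"
proof -
  have eqs: "b\<^sub>1\<^sub>1 * m\<^sub>3\<^sub>2 = b\<^sub>1\<^sub>2 * m\<^sub>3\<^sub>1" "b\<^sub>2\<^sub>1 * m\<^sub>3\<^sub>2 = b\<^sub>2\<^sub>2 * m\<^sub>3\<^sub>1"
    "(b\<^sub>1\<^sub>2 - b\<^sub>2\<^sub>1) * m\<^sub>3\<^sub>1 = b\<^sub>2\<^sub>1 * m\<^sub>1\<^sub>3 - b\<^sub>1\<^sub>1 * m\<^sub>2\<^sub>3" "(b\<^sub>1\<^sub>2 - b\<^sub>2\<^sub>1) * m\<^sub>3\<^sub>2 = b\<^sub>2\<^sub>2 * m\<^sub>1\<^sub>3 - b\<^sub>1\<^sub>2 * m\<^sub>2\<^sub>3"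
    using novikov_tri[OF assms] by simp_all
  show ?thesis
  proof (cases "m\<^sub>3\<^sub>1 = 0 \<and> m\<^sub>3\<^sub>2 = 0")
    case False
    then have r: "m\<^sub>3\<^sub>1 \<noteq> 0 \<or> m\<^sub>3\<^sub>2 \<noteq> 0" by blast
    obtain s\<^sub>1 where s1: "b\<^sub>1\<^sub>1 = s\<^sub>1 * m\<^sub>3\<^sub>1" "b\<^sub>1\<^sub>2 = s\<^sub>1 * m\<^sub>3\<^sub>2"
      using proportional_pair[OF _ r, of b\<^sub>1\<^sub>2 b\<^sub>1\<^sub>1] eqs(1) by (auto simp: mult.commute)
    obtain s\<^sub>2 where s2: "b\<^sub>2\<^sub>1 = s\<^sub>2 * m\<^sub>3\<^sub>1" "b\<^sub>2\<^sub>2 = s\<^sub>2 * m\<^sub>3\<^sub>2"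
      using proportional_pair[OF _ r, of b\<^sub>2\<^sub>2 b\<^sub>2\<^sub>1] eqs(2) by (auto simp: mult.commute)
    have "m\<^sub>3\<^sub>1 * (s\<^sub>1 * (m\<^sub>2\<^sub>3 + m\<^sub>3\<^sub>2) - s\<^sub>2 * (m\<^sub>1\<^sub>3 + m\<^sub>3\<^sub>1)) = 0" "m\<^sub>3\<^sub>2 * (s\<^sub>1 * (m\<^sub>2\<^sub>3 + m\<^sub>3\<^sub>2) - s\<^sub>2 * (m\<^sub>1\<^sub>3 + m\<^sub>3\<^sub>1)) = 0"
      using eqs(3,4) unfolding s1 s2 by algebra+
    then have st: "s\<^sub>1 * (m\<^sub>2\<^sub>3 + m\<^sub>3\<^sub>2) = s\<^sub>2 * (m\<^sub>1\<^sub>3 + m\<^sub>3\<^sub>1)" using r by auto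
    show ?thesis
    proof (cases "s\<^sub>1 = 0 \<and> s\<^sub>2 = 0")
      case True
      then show ?thesis unfolding s1 s2 using square_in_line_in_closure_N20 by simp
    next
      case False
      then obtain t where "m\<^sub>1\<^sub>3 + m\<^sub>3\<^sub>1 = t * s\<^sub>1" "m\<^sub>2\<^sub>3 + m\<^sub>3\<^sub>2 = t * s\<^sub>2"
        using proportional_pair[OF st] by blast
      then have "m\<^sub>1\<^sub>3 = t * s\<^sub>1 - m\<^sub>3\<^sub>1" "m\<^sub>2\<^sub>3 = t * s\<^sub>2 - m\<^sub>3\<^sub>2" by (simp_all add: eq_diff_eq)
      then show ?thesis unfolding s1 s2 using parametrised_in_closure_N20 by simp
    qed
  next
    case True
    show ?thesis
    proof (cases "m\<^sub>1\<^sub>3 = 0 \<and> m\<^sub>2\<^sub>3 = 0")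
      case l: False
      obtain w\<^sub>1 where "b\<^sub>1\<^sub>1 = w\<^sub>1 * m\<^sub>1\<^sub>3" "b\<^sub>2\<^sub>1 = w\<^sub>1 * m\<^sub>2\<^sub>3"
        using proportional_pair[of m\<^sub>1\<^sub>3 b\<^sub>2\<^sub>1 m\<^sub>2\<^sub>3 b\<^sub>1\<^sub>1] eqs(3) l True by (auto simp: mult.commute)
      moreover obtain w\<^sub>2 where "b\<^sub>1\<^sub>2 = w\<^sub>2 * m\<^sub>1\<^sub>3" "b\<^sub>2\<^sub>2 = w\<^sub>2 * m\<^sub>2\<^sub>3"
        using proportional_pair[of m\<^sub>1\<^sub>3 b\<^sub>2\<^sub>2 m\<^sub>2\<^sub>3 b\<^sub>1\<^sub>2] eqs(4) l True by (auto simp: mult.commute)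
      ultimately show ?thesis
        using left_annihilated_in_closure_N20[of m\<^sub>1\<^sub>3 w\<^sub>1 w\<^sub>2 m\<^sub>2\<^sub>3] True by (simp add: mult.commute)
    next
      case l: True
      show ?thesis using pencil_in_closure_N20 True l by simp
    qed
  qed
qed

section \<open>The closure of the second family\<close>

text \<open>
  The algebra is generated by \<open>e\<^sub>1\<close>, and so is \<open>N22 k\<close>, where \<open>k = 2 q / p\<close> is the ratio of the
  \<open>e\<^sub>3\<close>-components of \<open>(e\<^sub>1 e\<^sub>1) e\<^sub>1\<close> and \<open>e\<^sub>1 (e\<^sub>1 e\<^sub>1)\<close>. The \<open>e\<^sub>4\<close>-components need not have this ratio,
  but the generator \<open>e\<^sub>1 + x e\<^sub>2\<close> changes the defect by \<open>x\<close> times a factor that is nonzero under the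
  hypotheses.
\<close>

lemma generic_in_closure_N22:
  assumes "u \<noteq> 0" "v \<noteq> 0" "p \<noteq> 0" "q \<noteq> 0" "p \<noteq> 2 * q"
  shows "tri 1 0 (u * p) (2 * u * q) 0 0 m\<^sub>1\<^sub>2 (v * (p - q)) m\<^sub>2\<^sub>1 (u * v * p * q) 0 (v * q) 0 0
    \<in> closure_N22" (is "?c \<in> _")
proof -
  define x where "x = (p * m\<^sub>2\<^sub>1 - 2 * q * m\<^sub>1\<^sub>2) / (2 * u * v * q ^ 2 * (p - 2 * q))"
  have nz: "2 * u * v * q ^ 2 * (p - 2 * q) \<noteq> 0" using assms by simp
  have x: "x * (2 * u * v * q ^ 2 * (p - 2 * q)) = p * m\<^sub>2\<^sub>1 - 2 * q * m\<^sub>1\<^sub>2"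
    unfolding x_def using nz by (simp only: nonzero_divide_eq_eq nonzero_eq_divide_eq times_divide_eq_left) simp
  define k where "k = 2 * q / p"
  have k: "k * p = 2 * q" using assms by (simp add: k_def)
  define e where "e = u * v * p ^ 2 / 2"
  have e: "2 * e = u * v * p ^ 2" by (simp add: e_def)
  define h where "h = m\<^sub>1\<^sub>2 + x * u * v * ((p + 2 * q) * (p - q) + p * q)"
  let ?u1 = "vec4 1 x 0 0"
  let ?u2 = "vec4 0 1 (x * u * (p + 2 * q)) (x * (m\<^sub>1\<^sub>2 + m\<^sub>2\<^sub>1) + x ^ 2 * u * v * p * q)"
  let ?u3 = "vec4 0 0 (u * p) h"
  let ?u4 = "vec4 0 0 0 e"
  have inv: "invertible (from_cols ?u1 ?u2 ?u3 ?u4)"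
    using assms by (intro invertible_from_cols_block) (simp_all add: e_def)
  have h': "k * h = m\<^sub>2\<^sub>1 + x * u * v * q * (2 * p + 2 * q)"
  proof -
    have "p * (k * h) = p * (m\<^sub>2\<^sub>1 + x * u * v * q * (2 * p + 2 * q))"
      using k x unfolding h_def by algebra
    then show ?thesis using assms by simp
  qed
  have "gl_act (from_cols ?u1 ?u2 ?u3 ?u4) (N22 k) = ?c"
    unfolding N22_eq_tri
  proof (rule gl_act_tri_eqI[OF inv])
    show "alg_mult ?c ?u1 ?u1 = 1 *s ?u2 + 0 *s ?u3 + 0 *s ?u4"
      by (simp add: vec_eq_4) (simp add: algebra_simps power2_eq_square)
    show "alg_mult ?c ?u1 ?u2 = 1 *s ?u3 + 0 *s ?u4"
      by (simp add: vec_eq_4 h_def) (simp add: algebra_simps)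
    show "alg_mult ?c ?u1 ?u3 = (2 - k) *s ?u4"
    proof -
      have "u * p * (v * (p - q)) = (2 - k) * e" using k e by algebra
      then show ?thesis by (simp add: vec_eq_4 left_diff_distrib)
    qed
    show "alg_mult ?c ?u2 ?u1 = k *s ?u3 + 0 *s ?u4"
    proof -
      have "2 * u * q = k * (u * p)" using k by algebra
      then show ?thesis by (simp add: vec_eq_4 h') (simp add: algebra_simps)
    qed
    have ke: "k * e = u * v * p * q" using k e by algebra
    show "alg_mult ?c ?u2 ?u2 = 0 *s ?u3 + k *s ?u4"
      by (simp add: vec_eq_4 ke)
    show "alg_mult ?c ?u3 ?u1 = k *s ?u4"
      by (simp add: vec_eq_4 ke)
  qed (simp_all add: vec_eq_4)
  then show ?thesis using gl_act_in_orbit_closure[OF N22_in_closure inv] by metis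
qed

lemma parametrised_in_closure_N22:
  "tri 1 0 (u * p) (2 * u * q) 0 0 m\<^sub>1\<^sub>2 (v * (p - q)) m\<^sub>2\<^sub>1 (u * v * p * q) 0 (v * q) 0 0 \<in> closure_N22"
proof -
  let ?c = "\<lambda>\<tau>. tri 1 0 ((u + \<tau>) * (p + \<tau>)) (2 * (u + \<tau>) * (q + \<tau>)) 0 0 m\<^sub>1\<^sub>2
    ((v + \<tau>) * ((p + \<tau>) - (q + \<tau>))) m\<^sub>2\<^sub>1 ((u + \<tau>) * (v + \<tau>) * (p + \<tau>) * (q + \<tau>)) 0
    ((v + \<tau>) * (q + \<tau>)) 0 0"
  have lim: "(?c \<longlongrightarrow> ?c 0) (at 0)" by (intro tendsto_intros)
  have fin: "finite {- u, - v, - p, - q, p - 2 * q}" by simp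
  have "?c 0 \<in> closure_N22"
  proof (rule in_zariski_closure_by_limit[OF lim fin])
    fix \<tau> assume "\<tau> \<notin> {- u, - v, - p, - q, p - 2 * q}"
    then have "u + \<tau> \<noteq> 0" "v + \<tau> \<noteq> 0" "p + \<tau> \<noteq> 0" "q + \<tau> \<noteq> 0" "p + \<tau> \<noteq> 2 * (q + \<tau>)"
      by (auto simp: add_eq_0_iff eq_diff_eq algebra_simps)
    then show "?c \<tau> \<in> closure_N22" by (rule generic_in_closure_N22)
  qed
  then show ?thesis by simp
qed

text \<open>
  The equation that remains is \<open>2 b\<^sub>1\<^sub>2 m\<^sub>3\<^sub>1 = b\<^sub>2\<^sub>1 (m\<^sub>1\<^sub>3 + m\<^sub>3\<^sub>1)\<close>, the determinant of a two by two
  matrix; a factorisation of this matrix gives the parameters.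
\<close>

lemma novikov_tri_in_closure_N22:
  assumes "novikov (tri 1 0 b\<^sub>1\<^sub>2 b\<^sub>2\<^sub>1 b\<^sub>2\<^sub>2 0 m\<^sub>1\<^sub>2 m\<^sub>1\<^sub>3 m\<^sub>2\<^sub>1 m\<^sub>2\<^sub>2 m\<^sub>2\<^sub>3 m\<^sub>3\<^sub>1 m\<^sub>3\<^sub>2 0)"
  shows "tri 1 0 b\<^sub>1\<^sub>2 b\<^sub>2\<^sub>1 b\<^sub>2\<^sub>2 0 m\<^sub>1\<^sub>2 m\<^sub>1\<^sub>3 m\<^sub>2\<^sub>1 m\<^sub>2\<^sub>2 m\<^sub>2\<^sub>3 m\<^sub>3\<^sub>1 m\<^sub>3\<^sub>2 0 \<in> closure_N22"
proof -
  have eqs: "b\<^sub>2\<^sub>2 = 0" "m\<^sub>2\<^sub>2 = b\<^sub>1\<^sub>2 * m\<^sub>3\<^sub>1" "m\<^sub>2\<^sub>3 = 0" "m\<^sub>3\<^sub>2 = 0"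
    "(b\<^sub>1\<^sub>2 - b\<^sub>2\<^sub>1) * m\<^sub>3\<^sub>1 = b\<^sub>2\<^sub>1 * m\<^sub>1\<^sub>3 - m\<^sub>2\<^sub>2"
    using novikov_tri[OF assms] by simp_all
  then have "b\<^sub>1\<^sub>2 * (2 * m\<^sub>3\<^sub>1) = b\<^sub>2\<^sub>1 * (m\<^sub>1\<^sub>3 + m\<^sub>3\<^sub>1)" by algebra
  then obtain u v p q where pq: "b\<^sub>1\<^sub>2 = u * p" "b\<^sub>2\<^sub>1 = u * q" "m\<^sub>1\<^sub>3 + m\<^sub>3\<^sub>1 = v * p" "2 * m\<^sub>3\<^sub>1 = v * q"
    using rank_one_2x2 by blast
  have m31: "m\<^sub>3\<^sub>1 = v * (q / 2)" and b21: "b\<^sub>2\<^sub>1 = 2 * u * (q / 2)"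
    using pq by (simp_all add: field_simps)
  have m13: "m\<^sub>1\<^sub>3 = v * (p - q / 2)"
    using pq(3) unfolding m31 by (simp add: right_diff_distrib eq_diff_eq)
  have m22: "m\<^sub>2\<^sub>2 = u * v * p * (q / 2)"
    using eqs(2) unfolding pq(1) m31 by simp
  show ?thesis
    unfolding eqs(1,3,4) m31 m22 m13 b21 pq(1) by (rule parametrised_in_closure_N22)
qed

section \<open>Every nilpotent Novikov structure lies in one of the two closures\<close>

text \<open>
  If \<open>e\<^sub>3 e\<^sub>3 \<noteq> 0\<close>, all \<open>b\<^sub>i\<^sub>j\<close> except possibly \<open>b\<^sub>1\<^sub>1\<close> vanish, and another flag brings the structure
  into the form with \<open>a = 0\<close> and \<open>m\<^sub>3\<^sub>3 = 0\<close>.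
\<close>

lemma novikov_tri_in_closures:
  assumes "novikov (tri a b\<^sub>1\<^sub>1 b\<^sub>1\<^sub>2 b\<^sub>2\<^sub>1 b\<^sub>2\<^sub>2 m\<^sub>1\<^sub>1 m\<^sub>1\<^sub>2 m\<^sub>1\<^sub>3 m\<^sub>2\<^sub>1 m\<^sub>2\<^sub>2 m\<^sub>2\<^sub>3 m\<^sub>3\<^sub>1 m\<^sub>3\<^sub>2 m\<^sub>3\<^sub>3)" (is "novikov ?c")
  shows "?c \<in> closure_N20 \<union> closure_N22"
proof -
  note eqs = novikov_tri[OF assms]
  consider "a = 0" "m\<^sub>3\<^sub>3 = 0" | "a \<noteq> 0" "m\<^sub>3\<^sub>3 = 0" | "a = 0" "m\<^sub>3\<^sub>3 \<noteq> 0" | "a \<noteq> 0" "m\<^sub>3\<^sub>3 \<noteq> 0" by blast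
  then show ?thesis
  proof cases
    case 1
    then show ?thesis using assms novikov_tri_in_closure_N20 by simp
  next
    case 2
    \<comment> \<open>The square of \<open>e\<^sub>1\<close> becomes the second basis vector.\<close>
    let ?g = "from_cols (vec4 1 0 0 0) (vec4 0 a b\<^sub>1\<^sub>1 m\<^sub>1\<^sub>1) (vec4 0 0 1 0) (vec4 0 0 0 1)"
    let ?d = "tri 1 0 (a * b\<^sub>1\<^sub>2) (a * b\<^sub>2\<^sub>1) 0 0 (a * m\<^sub>1\<^sub>2 + b\<^sub>1\<^sub>1 * m\<^sub>1\<^sub>3) m\<^sub>1\<^sub>3 (a * m\<^sub>2\<^sub>1 + b\<^sub>1\<^sub>1 * m\<^sub>3\<^sub>1)
      (a * a * m\<^sub>2\<^sub>2) 0 m\<^sub>3\<^sub>1 0 0"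
    have "b\<^sub>2\<^sub>2 = 0" "m\<^sub>2\<^sub>3 = 0" "m\<^sub>3\<^sub>2 = 0" using eqs 2 by auto
    then have d: "gl_act ?g ?d = ?c"
      using 2 by (intro gl_act_tri_eqI invertible_from_cols_block) (simp_all add: vec_eq_4 mult_ac)
    have inv: "invertible ?g" using 2 by (intro invertible_from_cols_block) simp_all
    have "novikov ?d" using assms novikov_gl_act_iff[OF inv] d by metis
    then have "?d \<in> closure_N22" by (rule novikov_tri_in_closure_N22)
    from gl_act_in_orbit_closure[OF this inv] show ?thesis unfolding d by blast
  next
    case 3
    have z: "b\<^sub>1\<^sub>1 = 0" "b\<^sub>1\<^sub>2 = 0" "b\<^sub>2\<^sub>1 = 0" "b\<^sub>2\<^sub>2 = 0" using eqs 3 by auto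
    \<comment> \<open>Here \<open>A A\<close> lies in the line of \<open>e\<^sub>4\<close>; an isotropic vector \<open>e\<^sub>2 + k e\<^sub>3\<close> becomes the third one.\<close>
    obtain k where k: "m\<^sub>3\<^sub>3 * k ^ 2 + (m\<^sub>2\<^sub>3 + m\<^sub>3\<^sub>2) * k + m\<^sub>2\<^sub>2 = 0"
      using exists_quadratic_root[OF 3(2)] by blast
    let ?g = "from_cols (vec4 1 0 0 0) (vec4 0 0 1 0) (vec4 0 1 k 0) (vec4 0 0 0 1)"
    have inv: "invertible ?g"
      by (rule invertible_if_ker) (auto simp: from_cols_mult vec_eq_4)
    have k': "m\<^sub>2\<^sub>2 + k * m\<^sub>2\<^sub>3 + k * m\<^sub>3\<^sub>2 + k * k * m\<^sub>3\<^sub>3 = 0" using k by algebra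
    have "gl_act ?g (tri 0 0 0 0 0 m\<^sub>1\<^sub>1 m\<^sub>1\<^sub>3 (m\<^sub>1\<^sub>2 + k * m\<^sub>1\<^sub>3) m\<^sub>3\<^sub>1 m\<^sub>3\<^sub>3 (m\<^sub>3\<^sub>2 + k * m\<^sub>3\<^sub>3)
        (m\<^sub>2\<^sub>1 + k * m\<^sub>3\<^sub>1) (m\<^sub>2\<^sub>3 + k * m\<^sub>3\<^sub>3) 0) = ?c"
      by (rule gl_act_tri_eqI[OF inv]) (use k' in \<open>simp_all add: vec_eq_4 z 3\<close>)
    then show ?thesis using gl_act_in_orbit_closure[OF square_in_line_in_closure_N20 inv] by (metis UnI1)
  next
    case 4
    have z: "b\<^sub>1\<^sub>2 = 0" "b\<^sub>2\<^sub>1 = 0" "b\<^sub>2\<^sub>2 = 0" using eqs 4 by auto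
    \<comment> \<open>The new basis is \<open>e\<^sub>1, e\<^sub>3, e\<^sub>1 e\<^sub>1, e\<^sub>4\<close>.\<close>
    let ?g = "from_cols (vec4 1 0 0 0) (vec4 0 0 1 0) (vec4 0 a b\<^sub>1\<^sub>1 m\<^sub>1\<^sub>1) (vec4 0 0 0 1)"
    have inv: "invertible ?g"
      by (rule invertible_if_ker) (use 4 in \<open>auto simp: from_cols_mult vec_eq_4\<close>)
    let ?d = "tri 0 1 0 0 0 0 m\<^sub>1\<^sub>3 (a * m\<^sub>1\<^sub>2 + b\<^sub>1\<^sub>1 * m\<^sub>1\<^sub>3) m\<^sub>3\<^sub>1 m\<^sub>3\<^sub>3 0 (a * m\<^sub>2\<^sub>1 + b\<^sub>1\<^sub>1 * m\<^sub>3\<^sub>1) 0 0"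
    have "a * (a * m\<^sub>2\<^sub>2) + (a * (b\<^sub>1\<^sub>1 * m\<^sub>2\<^sub>3) + (a * (b\<^sub>1\<^sub>1 * m\<^sub>3\<^sub>2) + b\<^sub>1\<^sub>1 * (b\<^sub>1\<^sub>1 * m\<^sub>3\<^sub>3))) = 0"
      using eqs(2-4) z by algebra
    then have d: "gl_act ?g ?d = ?c"
      using eqs(3,4) by (intro gl_act_tri_eqI[OF inv]) (simp_all add: vec_eq_4 z algebra_simps)
    have "novikov ?d" using assms novikov_gl_act_iff[OF inv] d by metis
    then have "?d \<in> closure_N20" by (rule novikov_tri_in_closure_N20)
    from gl_act_in_orbit_closure[OF this inv] show ?thesis unfolding d by blast
  qed
qed

lemma nilpotent_novikov_subset: "nilpotent_novikov \<subseteq> closure_N20 \<union> closure_N22"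
proof
  fix c :: "4 alg_structure" assume "c \<in> nilpotent_novikov"
  then have "novikov c" "nilpotent_alg c" by (simp_all add: nilpotent_novikov_def)
  then obtain g d where "invertible g" "c = gl_act g d" "d \<in> closure_N20 \<union> closure_N22"
    using nilpotent_imp_triangular[of c] novikov_gl_act_iff novikov_tri_in_closures by metis
  then show "c \<in> closure_N20 \<union> closure_N22" using gl_act_in_orbit_closure by blast
qed

lemma closures_subset_nilpotent_novikov:
  "closure_N20 \<subseteq> nilpotent_novikov" "closure_N22 \<subseteq> nilpotent_novikov"
proof -
  have "gl_act g (N20 \<alpha>) \<in> nilpotent_novikov" "gl_act g (N22 \<alpha>) \<in> nilpotent_novikov"
    if "invertible g" for g \<alpha>
    using novikov_N20 novikov_N22 nilpotent_gl_act_tri[OF that]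
    by (simp_all add: nilpotent_novikov_def novikov_gl_act_iff that, simp_all add: N20_eq_tri N22_eq_tri)
  then have "(\<Union>\<alpha>. gl_orbit (N20 \<alpha>)) \<subseteq> nilpotent_novikov" "(\<Union>l. gl_orbit (N22 l)) \<subseteq> nilpotent_novikov"
    by (auto simp: gl_orbit_def)
  then show "closure_N20 \<subseteq> nilpotent_novikov" "closure_N22 \<subseteq> nilpotent_novikov"
    by (simp_all add: closure_of_minimal closedin_nilpotent_novikov)
qed

section \<open>Neither closure contains the other\<close>

text \<open>
  The identity \<open>x (y (z w)) = 0\<close> of the first family fails for \<open>N22 0\<close>, where
  \<open>e\<^sub>1 (e\<^sub>1 (e\<^sub>1 e\<^sub>1)) = 2 e\<^sub>4\<close>.
\<close>

lemma not_closure_N22_subset_closure_N20: "\<not> closure_N22 \<subseteq> closure_N20"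
proof -
  let ?e = "axis 1 1 :: complex ^ 4"
  define w where "w c = alg_mult c ?e (alg_mult c ?e (alg_mult c ?e ?e))" for c
  have "algebraic_set {c. \<forall>k. w c $ k = 0}"
    unfolding w_def
    by (intro algebraic_set_common_zeros polynomial_fun_alg_mult polynomial_fun.const)
  then have "closedin zariski {c. w c = 0}" by (simp add: closedin_zariski vec_eq_iff)
  moreover have "w (gl_act g (N20 \<alpha>)) = 0" if "invertible g" for g \<alpha>
  proof -
    have "alg_mult (N20 \<alpha>) x (alg_mult (N20 \<alpha>) y (alg_mult (N20 \<alpha>) z z')) = 0" for x y z z'
      by (simp add: vec_eq_4 N20_eq_tri)
    then show ?thesis by (simp add: w_def alg_mult_gl_act matrix_inv_mult that)
  qed
  ultimately have "closure_N20 \<subseteq> {c. w c = 0}"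
    by (intro closure_of_minimal) (auto simp: gl_orbit_def)
  moreover have "w (N22 0) \<noteq> 0"
    by (simp add: w_def vec_eq_4 N22_eq_tri axis_def)
  ultimately show ?thesis using N22_in_closure[of 0] by blast
qed

text \<open>
  The double commutators of \<open>N22 l\<close> lie on a line and depend on \<open>z\<close> through \<open>z $ 1\<close> only. Unless
  all of them vanish, the hyperplane \<open>z $ 1 = 0\<close> is thus determined by the structure, without
  reference to the basis.
\<close>

lemma N22_double_commutator:
  fixes l and x y :: "complex ^ 4"
  defines "m \<equiv> alg_mult (N22 l)"
  shows "\<exists>K. \<forall>z. m (m x y - m y x) z - m z (m x y - m y x) = (K * z $ 1) *s axis 4 1"
  unfolding m_def
  by (intro exI[of _ "- 2 * (1 - l) ^ 2 * (x $ 1 * y $ 2 - x $ 2 * y $ 1)"])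
    (simp add: vec_eq_4 N22_eq_tri axis_def power2_eq_square algebra_simps)

lemma N22_square_annihilates:
  "x $ 1 = 0 \<Longrightarrow> alg_mult (N22 l) (alg_mult (N22 l) x x) y = 0"
  by (simp add: vec_eq_4 N22_eq_tri)

text \<open>
  For \<open>f z = [[e\<^sub>1, e\<^sub>2], z]\<close>, a fixed linear functional \<open>\<phi>\<close> and vectors \<open>x, y\<close>, the vector
  \<open>\<phi> (f x) y - \<phi> (f y) x\<close> lies in the hyperplane of \<open>N22_double_commutator\<close> for every structure
  isomorphic to an \<open>N22 l\<close>, so its square annihilates everything from the left. For \<open>N20 0\<close> this
  fails with \<open>\<phi>\<close> the fourth coordinate and \<open>x, y = e\<^sub>1, e\<^sub>2\<close>.
\<close>

lemma not_closure_N20_subset_closure_N22: "\<not> closure_N20 \<subseteq> closure_N22"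
proof -
  let ?e1 = "axis 1 1 :: complex ^ 4" and ?e2 = "axis 2 1 :: complex ^ 4"
  define br where "br c = alg_mult c ?e1 ?e2 - alg_mult c ?e2 ?e1" for c
  define f where "f c z = (alg_mult c (br c) z - alg_mult c z (br c)) $ 4" for c z
  define v where "v c = f c ?e1 *s ?e2 - f c ?e2 *s ?e1" for c
  define w where "w c = alg_mult c (alg_mult c (v c) (v c)) ?e2" for c
  have "polynomial_fun (\<lambda>c. br c $ k)" for k
    unfolding br_def vector_minus_component
    by (intro polynomial_fun_diff polynomial_fun_alg_mult polynomial_fun.const)
  then have "polynomial_fun (\<lambda>c. f c z)" for z
    unfolding f_def vector_minus_component
    by (intro polynomial_fun_diff polynomial_fun_alg_mult polynomial_fun.const)
  then have "polynomial_fun (\<lambda>c. v c $ k)" for k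
    unfolding v_def vector_minus_component vector_smult_component
    by (intro polynomial_fun_diff polynomial_fun.mult polynomial_fun.const)
  then have "algebraic_set {c. \<forall>k. w c $ k = 0}"
    unfolding w_def
    by (intro algebraic_set_common_zeros polynomial_fun_alg_mult polynomial_fun.const)
  then have "closedin zariski {c. w c = 0}" by (simp add: closedin_zariski vec_eq_iff)
  moreover have "w (gl_act g (N22 l)) = 0" if g: "invertible g" for g l
  proof -
    let ?c = "gl_act g (N22 l)" and ?h = "matrix_inv g" and ?m = "alg_mult (N22 l)"
    have br: "br ?c = g *v (?m (?h *v ?e1) (?h *v ?e2) - ?m (?h *v ?e2) (?h *v ?e1))"
      by (simp add: br_def alg_mult_gl_act matrix_vector_mult_diff_distrib)
    obtain K where K: "\<And>z. ?m (?h *v br ?c) z - ?m z (?h *v br ?c) = (K * z $ 1) *s axis 4 1"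
      using N22_double_commutator[of l "?h *v ?e1" "?h *v ?e2"] unfolding br matrix_inv_mult(4)[OF g] by blast
    have f: "f ?c z = K * (?h *v z) $ 1 * (g *v axis 4 1) $ 4" for z
      by (simp add: f_def alg_mult_gl_act K vec.scale flip: matrix_vector_mult_diff_distrib vector_minus_component)
    have "(?h *v v ?c) $ 1 = 0"
      by (simp add: v_def f vec.diff vec.scale)
    then have "?m (?m (?h *v v ?c) (?h *v v ?c)) (?h *v ?e2) = 0" by (rule N22_square_annihilates)
    then show ?thesis by (simp add: w_def alg_mult_gl_act matrix_inv_mult g)
  qed
  ultimately have "closure_N22 \<subseteq> {c. w c = 0}"
    by (intro closure_of_minimal) (auto simp: gl_orbit_def)
  moreover have "w (N20 0) \<noteq> 0"
    by (simp add: w_def v_def f_def br_def vec_eq_4 N20_eq_tri axis_def)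
  ultimately show ?thesis using N20_in_closure[of 0] by blast
qed

section \<open>The irreducible components\<close>

lemma coordinates_of_families:
  "\<exists>q. \<forall>t. N20 t $ i = poly q t" "\<exists>q. \<forall>t. N22 t $ i = poly q t"
proof -
  have ax: "axis j (poly a t) $ i = poly (if i = j then a else 0) t" for j :: "4 \<times> 4 \<times> 4" and a and t :: complex
    by (simp add: axis_def)
  show "\<exists>q. \<forall>t. N20 t $ i = poly q t"
  proof (rule exI, rule allI)
    fix t
    have "N20 t = axis (1, 2, 3) (poly 1 t) + axis (1, 1, 4) (poly [:0, 1:] t) + axis (1, 3, 4) (poly 1 t)
          + axis (2, 2, 4) (poly 1 t) + axis (2, 3, 4) (poly 1 t) + axis (3, 2, 4) (poly (- 1) t)"
      by (simp add: N20_def)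
    then show "N20 t $ i = poly ((if i = (1, 2, 3) then 1 else 0) + (if i = (1, 1, 4) then [:0, 1:] else 0)
        + (if i = (1, 3, 4) then 1 else 0) + (if i = (2, 2, 4) then 1 else 0)
        + (if i = (2, 3, 4) then 1 else 0) + (if i = (3, 2, 4) then - 1 else 0)) t"
      by (simp only: vector_add_component ax poly_add)
  qed
  show "\<exists>q. \<forall>t. N22 t $ i = poly q t"
  proof (rule exI, rule allI)
    fix t
    have "N22 t = axis (1, 1, 2) (poly 1 t) + axis (1, 2, 3) (poly 1 t) + axis (1, 3, 4) (poly [:2, - 1:] t)
          + axis (2, 1, 3) (poly [:0, 1:] t) + axis (2, 2, 4) (poly [:0, 1:] t) + axis (3, 1, 4) (poly [:0, 1:] t)"
      by (simp add: N22_def)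
    then show "N22 t $ i = poly ((if i = (1, 1, 2) then 1 else 0) + (if i = (1, 2, 3) then 1 else 0)
        + (if i = (1, 3, 4) then [:2, - 1:] else 0) + (if i = (2, 1, 3) then [:0, 1:] else 0)
        + (if i = (2, 2, 4) then [:0, 1:] else 0) + (if i = (3, 1, 4) then [:0, 1:] else 0)) t"
      by (simp only: vector_add_component ax poly_add)
  qed
qed

theorem theorem8:
  "card (irreducible_components (subtopology zariski (nilpotent_novikov :: 4 alg_structure set))) = 2 \<and>
   irreducible_components (subtopology zariski (nilpotent_novikov :: 4 alg_structure set)) =
     {zariski closure_of (\<Union>\<alpha>. gl_orbit (N20 \<alpha>)),
      zariski closure_of (\<Union>l. gl_orbit (N22 l))}"
proof -
  let ?X = "subtopology zariski (nilpotent_novikov :: 4 alg_structure set)"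
  have "irreducible_in zariski closure_N20" "irreducible_in zariski closure_N22"
    by (intro irreducible_in_closure_of irreducible_union_of_orbits coordinates_of_families)+
  then have irr: "irreducible_in ?X closure_N20" "irreducible_in ?X closure_N22"
    using closures_subset_nilpotent_novikov closedin_nilpotent_novikov
    by (auto intro: irreducible_in_subtopology)
  have closed: "closedin ?X closure_N20" "closedin ?X closure_N22"
    using closures_subset_nilpotent_novikov closedin_nilpotent_novikov
    by (simp_all add: closedin_closed_subtopology)
  have "topspace ?X = closure_N20 \<union> closure_N22"
    using nilpotent_novikov_subset closures_subset_nilpotent_novikov by auto
  then have "irreducible_components ?X = {closure_N20, closure_N22}"
    using irreducible_components_of_union[OF closed irr] not_closure_N20_subset_closure_N22
      not_closure_N22_subset_closure_N20 by blast
  moreover have "closure_N20 \<noteq> closure_N22" using not_closure_N20_subset_closure_N22 by blast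
  ultimately show ?thesis by simp
qed

end
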